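(* Let $\{\mu_t\}_{t\ge0}$ be a weakly continuous $\rhd$-convolution semigroup with $\mu_0=\delta_0$, with associated pair $(\gamma,\tau)$. The following are equivalent: (1) there exists $t_0>0$ such that $\operatorname{supp}\mu_{t_0}\subset[0,\infty)$; (2) $\operatorname{supp}\mu_t\subset[0,\infty)$ for all $0\le t<\infty$; (3) $\operatorname{supp}\tau\subset[0,\infty)$, $\tau(\{0\})=0$, $\int_0^\infty\frac1x\,d\tau(x)<\infty$ and $\gamma\ge\int_0^\infty\frac1x\,d\tau(x)$.
   Context: For a probability measure $\mu$ on $\mathbb{R}$, $G_\mu(z)=\int\frac{1}{z-x}d\mu(x)$ on $\mathbb{C}^+$ and $H_\mu=1/G_\mu$; the monotone convolution $\mu\rhd\nu$ is the unique probability measure with $H_{\mu\rhd\nu}=H_\mu\circ H_\nu$. A weakly continuous $\rhd$-convolution semigroup is a family $\{\mu_t\}_{t\ge0}$ of probability measures, weakly continuous in $t$, with $\mu_s\rhd\mu_t=\mu_{s+t}$. It is known that for such a semigroup with $\mu_0=\delta_0$ there is a unique pair $(\gamma,\tau)$, $\gamma\in\mathbb{R}$, $\tau$ a positive finite measure, such that with the vector field $A(z)=-\gamma+\int_{\mathbb{R}}\frac{1+xz}{x-z}\,d\tau(x)$, the maps $H_t:=H_{\mu_t}$ solve $\frac{d}{dt}H_t(z)=A(H_t(z))$, $H_0(z)=z$, for $z\in\mathbb{C}\setminus\mathbb{R}$; $(\gamma,\tau)$ is called the associated pair. *)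

theory Defs
  imports "HOL-Probability.Probability"
begin

definition cauchy_G :: "real measure \<Rightarrow> complex \<Rightarrow> complex" where
  "cauchy_G M z = (\<integral>x. 1 / (z - complex_of_real x) \<partial>M)"

definition recip_H :: "real measure \<Rightarrow> complex \<Rightarrow> complex" where
  "recip_H M z = 1 / cauchy_G M z"

definition measure_support :: "real measure \<Rightarrow> real set" where
  "measure_support M = {x. \<forall>e>0. emeasure M (ball x e) > 0}"

definition monotone_field :: "real \<Rightarrow> real measure \<Rightarrow> complex \<Rightarrow> complex" where
  "monotone_field \<gamma> \<tau> z =
     - complex_of_real \<gamma> + (\<integral>x. (1 + complex_of_real x * z) / (complex_of_real x - z) \<partial>\<tau>)"

definition monotone_semigroup :: "(real \<Rightarrow> real measure) \<Rightarrow> bool" where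
  "monotone_semigroup \<mu> \<longleftrightarrow>
     (\<forall>t\<ge>0. prob_space (\<mu> t) \<and> sets (\<mu> t) = sets borel) \<and>
     \<mu> 0 = return borel 0 \<and>
     (\<forall>t\<ge>0. \<forall>f::real \<Rightarrow> real. continuous_on UNIV f \<and> bounded (range f) \<longrightarrow>
        ((\<lambda>s. \<integral>x. f x \<partial>\<mu> s) \<longlongrightarrow> (\<integral>x. f x \<partial>\<mu> t)) (at t within {0..})) \<and>
     (\<forall>s\<ge>0. \<forall>t\<ge>0. \<forall>z. Im z > 0 \<longrightarrow>
        recip_H (\<mu> (s + t)) z = recip_H (\<mu> s) (recip_H (\<mu> t) z))"

definition associated_pair :: "(real \<Rightarrow> real measure) \<Rightarrow> real \<Rightarrow> real measure \<Rightarrow> bool" where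
  "associated_pair \<mu> \<gamma> \<tau> \<longleftrightarrow>
     finite_measure \<tau> \<and> sets \<tau> = sets borel \<and>
     (\<forall>z. Im z \<noteq> 0 \<longrightarrow> recip_H (\<mu> 0) z = z \<and>
        (\<forall>t\<ge>0. ((\<lambda>s. recip_H (\<mu> s) z) has_vector_derivative
                   monotone_field \<gamma> \<tau> (recip_H (\<mu> t) z)) (at t within {0..})))"

end

theory Submission
  imports Defs "HOL-Complex_Analysis.Complex_Analysis"
begin

text \<open>
  Write \<open>H t\<close> for the flow and \<open>A\<close> for its vector field.

  (3) implies (2): condition (3) gives \<open>Re (A z) \<le> 0\<close> for \<open>Re z \<le> 0\<close>, so \<open>Re (H t z)\<close> never exceeds
  \<open>Re z\<close> when \<open>Re z < 0\<close>, and there \<open>Im (A w)\<close> is at most a multiple of \<open>Im w\<close>. Hence \<open>Im (H t z)\<close> is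
  \<open>O(Im z)\<close> near the negative axis, where \<open>\<mu> t\<close> then has no mass by Stieltjes inversion.

  (1) implies (3): differentiating the semigroup law gives \<open>(H s)' A = A \<circ> H s\<close>, so the time average
  \<open>F z = integral {0..t0} (\<lambda>s. H s z)\<close> satisfies \<open>F' z * A z = H t0 z - z\<close>. Since \<open>Im (H s z)\<close> increases
  with \<open>s\<close>, \<open>Im (F z)\<close> lies between \<open>t0 * Im z\<close> and \<open>t0 * Im (H t0 z)\<close>, and the latter is \<open>O(Im z)\<close> near
  the negative axis. By Schwarz-Pick and Schwarz reflection \<open>F'\<close> extends to the negative axis with
  real values at least \<open>t0\<close>. As \<open>H t0 u \<le> u\<close> for \<open>u < 0\<close>, the field \<open>A\<close> has nonpositive real boundary
  values there; so \<open>\<tau>\<close> has no mass on the negative axis, and letting \<open>u\<close> increase to 0 in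
  \<open>A u \<le> 0\<close> yields the remaining conditions.
\<close>

section \<open>Boundary derivatives of self-maps of the half-plane\<close>

lemma open_upper_half_plane: "open {z. 0 < Im z}"
  by (simp add: open_Collect_less continuous_on_Im continuous_on_id)

text \<open>Schwarz-Pick up to a constant. Starting from a disc inside the half-plane instead of the
  half-plane itself costs the factor 2, which is harmless since only boundedness of the derivative
  is wanted later.\<close>

lemma half_plane_deriv_bound:
  assumes holf: "f holomorphic_on {z. 0 < Im z}"
    and f: "\<And>z. 0 < Im z \<Longrightarrow> 0 < Im (f z)" and z: "0 < Im z"
  shows "norm (deriv f z) \<le> 2 * Im (f z) / Im z"
proof -
  define r where "r = Im z"
  have r: "0 < r" using z by (simp add: r_def)
  \<comment> \<open>the Schwarz lemma on the disc of radius \<open>Im z\<close> about \<open>z\<close>, after a Moebius map sending \<open>f z\<close> to 0\<close>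
  define e where "e = (\<lambda>\<zeta>. z + of_real r * \<zeta>)"
  have e: "0 < Im (e \<zeta>)" if "norm \<zeta> < 1" for \<zeta>
  proof -
    have "\<bar>Im \<zeta>\<bar> < 1" using that abs_Im_le_cmod[of \<zeta>] by linarith
    then have "r * (1 + Im \<zeta>) > 0" using r by simp
    then show ?thesis by (simp add: e_def r_def algebra_simps)
  qed
  define g where "g = (\<lambda>\<zeta>. (f (e \<zeta>) - f z) / (f (e \<zeta>) - cnj (f z)))"
  have nz: "w - cnj (f z) \<noteq> 0" if "0 < Im w" for w
    using that f[OF z] by (auto simp: complex_eq_iff)
  \<comment> \<open>The two squared norms differ by \<open>4 * Im w * Im (f z)\<close>: a point of
    the upper half-plane is closer to \<open>f z\<close> than to its mirror image.\<close>
  have lt: "norm (w - f z) < norm (w - cnj (f z))" if "0 < Im w" for w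
  proof -
    have "norm (w - f z)^2 < norm (w - cnj (f z))^2"
      using mult_pos_pos[OF that f[OF z]] unfolding cmod_power2 by (simp add: algebra_simps power2_eq_square)
    then show ?thesis by (simp add: power2_less_imp_less)
  qed
  have hole: "(\<lambda>\<zeta>. f (e \<zeta>)) holomorphic_on ball 0 1"
    by (rule holomorphic_on_compose_gen[OF _ holf, unfolded o_def])
       (use e in \<open>auto intro!: holomorphic_intros simp: e_def\<close>)
  have holg: "g holomorphic_on ball 0 1"
    unfolding g_def by (intro holomorphic_intros hole) (use nz f e in auto)
  have g0: "g 0 = 0" by (simp add: g_def e_def)
  have g1: "norm (g \<zeta>) < 1" if "norm \<zeta> < 1" for \<zeta>
    using lt[OF f[OF e[OF that]]] nz[OF f[OF e[OF that]]] by (simp add: g_def norm_divide divide_less_eq)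
  have "norm (deriv g 0) \<le> 1"
    by (rule Schwarz_Lemma(2)[OF holg g0 g1, of 0]) auto
  have df: "(f has_field_derivative deriv f z) (at z)"
    using holf z open_upper_half_plane holomorphic_derivI by blast
  have "((\<lambda>\<zeta>. f (e \<zeta>)) has_field_derivative (deriv f z * of_real r)) (at 0)"
    by (rule DERIV_chain2[of f])
       (use df in \<open>auto intro!: derivative_eq_intros simp: e_def\<close>)
  then have "(g has_field_derivative (deriv f z * of_real r) / (f z - cnj (f z))) (at 0)"
    unfolding g_def using nz[OF f[OF z]]
    by (auto intro!: derivative_eq_intros simp: e_def power2_eq_square)
  then have "deriv g 0 = (deriv f z * of_real r) / (f z - cnj (f z))" by (rule DERIV_imp_deriv)
  moreover have "norm (f z - cnj (f z)) = 2 * Im (f z)"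
  proof -
    have "f z - cnj (f z) = of_real (2 * Im (f z)) * \<i>" by (simp add: complex_eq_iff)
    then show ?thesis using f[OF z] by (simp add: norm_mult)
  qed
  ultimately have "norm (deriv f z) * r / (2 * Im (f z)) \<le> 1"
    using \<open>norm (deriv g 0) \<le> 1\<close> r by (simp add: norm_divide norm_mult)
  then show ?thesis using r f[OF z] by (simp add: field_simps r_def)
qed

text \<open>Real points of the disc are approached from vertically above. A continuous extension to
  the closure of the open half-disc therefore reaches the real diameter, as the reflection principle
  requires.\<close>

lemma half_ball_subset_closure:
  fixes u :: real
  assumes "norm (z - of_real u) < r" "0 \<le> Im z"
  shows "z \<in> closure (ball (of_real u) r \<inter> {z. 0 < Im z})"
proof (cases "Im z = 0")
  case False
  then show ?thesis using assms
    by (intro subsetD[OF closure_subset]) (auto simp: dist_norm norm_minus_commute)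
next
  case True
  show ?thesis unfolding closure_approachable
  proof (intro allI impI)
    fix e :: real assume "0 < e"
    define d where "d = min e (r - norm (z - of_real u)) / 2"
    have d: "0 < d" "d < e" "d < r - norm (z - of_real u)" using \<open>0 < e\<close> assms by (auto simp: d_def min_def field_simps)
    have "norm (z + \<i> * d - of_real u) \<le> norm (z - of_real u) + norm (\<i> * of_real d)"
      by (metis add_diff_eq diff_add_eq norm_triangle_ineq)
    also have "\<dots> < r" using d by (simp add: norm_mult)
    finally have "z + \<i> * d \<in> ball (of_real u) r \<inter> {z. 0 < Im z}"
      using d True by (auto simp: dist_norm norm_minus_commute)
    moreover have "dist (z + \<i> * d) z < e" using d by (simp add: dist_norm norm_mult)
    ultimately show "\<exists>y\<in>ball (of_real u) r \<inter> {z. 0 < Im z}. dist y z < e" by blast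
  qed
qed

text \<open>The upper bound and Schwarz-Pick bound \<open>deriv f\<close> near \<open>u\<close>, so
  \<open>f\<close> is Lipschitz there and extends to the real diameter. The two bounds on
  \<open>Im (f z)\<close> pinch it to 0 on that diameter, so the reflected function is holomorphic
  across \<open>u\<close>. Its derivative at \<open>u\<close> is real because the function is real
  on the axis, and at least \<open>c\<close> because of the growth of \<open>Im (f z)\<close> in the
  vertical direction.\<close>

lemma half_plane_deriv_boundary_limit:
  fixes u :: real
  assumes holf: "f holomorphic_on {z. 0 < Im z}" and "0 < c" "0 < r"
    and lower: "\<And>z. 0 < Im z \<Longrightarrow> c * Im z \<le> Im (f z)"
    and upper: "\<And>z. \<lbrakk>0 < Im z; norm (z - of_real u) < r\<rbrakk> \<Longrightarrow> Im (f z) \<le> C * Im z"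
  obtains L :: real where "c \<le> L" "(deriv f \<longlongrightarrow> of_real L) (at (of_real u) within {z. 0 < Im z})"
proof -
  define S where "S = ball (of_real u :: complex) r"
  define U where "U = S \<inter> {z. 0 < Im z}"
  have pos: "0 < Im (f z)" if "0 < Im z" for z
    using lower[OF that] mult_pos_pos[OF \<open>0 < c\<close> that] by linarith
  \<comment> \<open>Comparing the bounds at one point above \<open>u\<close> forces this;
    \<open>2 * C\<close> then serves as a Lipschitz constant.\<close>
  have "0 < C"
  proof -
    define z where "z = of_real u + \<i> * of_real (r/2)"
    have z: "0 < Im z" "norm (z - of_real u) < r" using \<open>0 < r\<close> by (auto simp: z_def norm_mult)
    from pos[OF z(1)] upper[OF z] have "0 < C * Im z" by linarith
    then show ?thesis using z(1) by (simp add: zero_less_mult_iff)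
  qed
  have openU: "open U" unfolding U_def S_def by (intro open_Int open_upper_half_plane) auto
  have convU: "convex U" unfolding U_def S_def
    by (intro convex_Int convex_halfspace_Im_gt) auto
  have "norm (f z - f w) \<le> 2 * C * norm (z - w)" if "z \<in> U" "w \<in> U" for z w
  proof (rule field_differentiable_bound[OF convU _ _ that(1,2)])
    fix x assume x: "x \<in> U"
    then have x': "0 < Im x" "norm (x - of_real u) < r"
      by (auto simp: U_def S_def dist_norm norm_minus_commute)
    show "(f has_field_derivative deriv f x) (at x within U)"
      using holf x'(1) open_upper_half_plane holomorphic_derivI has_field_derivative_at_within by blast
    have "norm (deriv f x) \<le> 2 * Im (f x) / Im x"
      by (rule half_plane_deriv_bound[OF holf pos x'(1)])
    also have "\<dots> \<le> 2 * (C * Im x) / Im x"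
      using upper[OF x'] x'(1) by (intro divide_right_mono mult_left_mono) auto
    finally show "norm (deriv f x) \<le> 2 * C" using x'(1) by simp
  qed
  then have "(2 * C)-lipschitz_on U f"
    by (intro lipschitz_onI) (use \<open>0 < C\<close> in \<open>auto simp: dist_norm\<close>)
  then obtain g where g: "(2 * C)-lipschitz_on (closure U) g" "\<And>z. z \<in> U \<Longrightarrow> g z = f z"
    using lipschitz_extend_closure by blast
  have contg: "continuous_on (closure U) g" using g(1) lipschitz_on_continuous_on by blast
  have sub: "S \<inter> {z. 0 \<le> Im z} \<subseteq> closure U"
    unfolding S_def U_def using half_ball_subset_closure by (auto simp: dist_norm norm_minus_commute)
  have fupper: "Im (f z) \<le> C * Im z" if "z \<in> U" for z
    using upper[of z] that by (simp add: U_def S_def dist_norm norm_minus_commute)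
  \<comment> \<open>Both linear bounds pass to the closure by continuity. At real points they read
    \<open>0 \<le> Im (g z) \<le> 0\<close>.\<close>
  have Img: "c * Im z \<le> Im (g z)" "Im (g z) \<le> C * Im z" if "z \<in> closure U" for z
  proof -
    have "c * Im z - Im (g z) \<le> 0"
      by (rule continuous_le_on_closure[OF _ that])
         (use contg g lower in \<open>auto intro!: continuous_intros simp: U_def\<close>)
    then show "c * Im z \<le> Im (g z)" by simp
    have "Im (g z) - C * Im z \<le> 0"
      by (rule continuous_le_on_closure[OF _ that])
         (use contg g fupper in \<open>auto intro!: continuous_intros\<close>)
    then show "Im (g z) \<le> C * Im z" by simp
  qed
  define h where "h = (\<lambda>z. if 0 \<le> Im z then g z else cnj (g (cnj z)))"
  have holh: "h holomorphic_on S"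
    unfolding h_def
  proof (rule Schwarz_reflection)
    show "open S" by (simp add: S_def)
    show "cnj ` S \<subseteq> S"
    proof safe
      fix z assume "z \<in> S"
      moreover have "norm (cnj z - of_real u) = norm (z - of_real u)"
        by (metis complex_cnj_complex_of_real complex_cnj_diff complex_mod_cnj)
      ultimately show "cnj z \<in> S" by (simp add: S_def dist_norm norm_minus_commute)
    qed
    have "f holomorphic_on U" using holf by (rule holomorphic_on_subset) (auto simp: U_def)
    then have "g holomorphic_on U" by (rule holomorphic_transform) (simp add: g)
    then show "g holomorphic_on S \<inter> {z. 0 < Im z}" by (simp add: U_def)
    show "continuous_on (S \<inter> {z. 0 \<le> Im z}) g" by (rule continuous_on_subset[OF contg sub])
    fix z assume z: "z \<in> S" "z \<in> \<real>"
    then have "Im z = 0" by (simp add: complex_is_Real_iff)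
    with Img[of z] sub z have "Im (g z) = 0" by force
    then show "g z \<in> \<real>" by (simp add: complex_is_Real_iff)
  qed
  have uS: "of_real u \<in> S" using \<open>0 < r\<close> by (simp add: S_def)
  have openS: "open S" by (simp add: S_def)
  have dh: "(h has_field_derivative deriv h (of_real u)) (at (of_real u))"
    using holh openS uS holomorphic_derivI by blast
  have huReal: "Im (h (of_real v)) = 0" if "of_real v \<in> S" for v :: real
    using Img[of "of_real v"] sub that by (force simp: h_def)
  \<comment> \<open>Difference quotients along the ray in direction \<open>k\<close>:
    \<open>k = 1\<close> will show that the derivative is real, \<open>k = \<i>\<close> will bound
    it from below.\<close>
  have lim: "((\<lambda>t. (h (of_real u + k * of_real t) - h (of_real u)) / (k * of_real t)) \<longlongrightarrow> deriv h (of_real u)) (at_right 0)"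
    if "k \<noteq> 0" for k
  proof -
    have "filterlim (\<lambda>t. k * complex_of_real t) (at 0) (at_right (0::real))"
    proof (rule filterlim_atI)
      have "((\<lambda>t. k * complex_of_real t) \<longlongrightarrow> k * of_real 0) (at_right (0::real))" by (intro tendsto_intros)
      then show "((\<lambda>t. k * complex_of_real t) \<longlongrightarrow> 0) (at_right (0::real))" by simp
      show "\<forall>\<^sub>F x in at_right 0. k * complex_of_real x \<noteq> 0"
        using that eventually_at_right_less[of "0::real"] by (auto elim: eventually_mono)
    qed
    from filterlim_compose[OF dh[unfolded DERIV_def] this] show ?thesis .
  qed
  have evS: "\<forall>\<^sub>F t in at_right 0. of_real u + k * of_real t \<in> S" for k
  proof -
    have "((\<lambda>t. of_real u + k * complex_of_real t) \<longlongrightarrow> of_real u + k * of_real 0) (at_right (0::real))"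
      by (intro tendsto_intros)
    then show ?thesis using openS uS topological_tendstoD by fastforce
  qed
  have "Im (deriv h (of_real u)) = 0"
  proof -
    have "((\<lambda>t. Im ((h (of_real u + 1 * of_real t) - h (of_real u)) / (1 * of_real t))) \<longlongrightarrow> Im (deriv h (of_real u))) (at_right 0)"
      by (intro tendsto_intros lim) simp
    moreover have "\<forall>\<^sub>F t in at_right 0. Im ((h (of_real u + 1 * of_real t) - h (of_real u)) / (1 * of_real t)) = 0"
      using evS[of 1]
    proof eventually_elim
      case (elim t)
      then show ?case using huReal[of "u + t"] huReal[of u] uS by simp
    qed
    ultimately have "((\<lambda>t. 0) \<longlongrightarrow> Im (deriv h (of_real u))) (at_right (0::real))"
      by (rule Lim_transform_eventually)
    then show ?thesis by (simp add: tendsto_const_iff)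
  qed
  \<comment> \<open>Since \<open>h\<close> is real at \<open>u\<close>, the vertical quotient has
    real part \<open>Im (g (u + \<i> * t)) / t\<close>, and the lower bound makes this at least
    \<open>c\<close>.\<close>
  moreover have "c \<le> Re (deriv h (of_real u))"
  proof (rule tendsto_lowerbound)
    show "((\<lambda>t. Re ((h (of_real u + \<i> * of_real t) - h (of_real u)) / (\<i> * of_real t))) \<longlongrightarrow> Re (deriv h (of_real u))) (at_right 0)"
      by (intro tendsto_intros lim) simp
    show "\<forall>\<^sub>F t in at_right 0. c \<le> Re ((h (of_real u + \<i> * of_real t) - h (of_real u)) / (\<i> * of_real t))"
      using evS[of \<i>] eventually_at_right_less[of "0::real"]
    proof eventually_elim
      case (elim t)
      have "h (of_real u + \<i> * of_real t) = g (of_real u + \<i> * of_real t)" using elim by (simp add: h_def)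
      moreover have "c * t \<le> Im (g (of_real u + \<i> * of_real t))"
        using Img(1)[of "of_real u + \<i> * of_real t"] sub elim by force
      moreover have "Re (w / (\<i> * of_real t)) = Im w / t" for w
        using elim by (simp add: Re_divide power2_eq_square)
      ultimately show ?case using huReal[of u] uS elim by (simp add: pos_le_divide_eq)
    qed
  qed simp
  moreover have "(deriv f \<longlongrightarrow> deriv h (of_real u)) (at (of_real u) within {z. 0 < Im z})"
  proof -
    have "deriv h holomorphic_on S" using holh openS by (rule holomorphic_deriv)
    then have "isCont (deriv h) (of_real u)"
      using openS uS continuous_on_eq_continuous_at holomorphic_on_imp_continuous_on by blast
    then have "(deriv h \<longlongrightarrow> deriv h (of_real u)) (at (of_real u) within {z. 0 < Im z})"
      by (meson isCont_def tendsto_within_subset subset_UNIV)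
    moreover have "\<forall>\<^sub>F z in at (of_real u) within {z. 0 < Im z}. deriv h z = deriv f z"
    proof -
      have "deriv h z = deriv f z" if "z \<in> U" for z
        by (rule deriv_cong_ev)
           (use that openU g in \<open>auto simp: eventually_nhds h_def U_def intro!: exI[of _ U]\<close>)
      moreover have "\<forall>\<^sub>F z in at (of_real u) within {z. 0 < Im z}. z \<in> U"
        using uS openS by (auto simp: eventually_at_topological U_def)
      ultimately show ?thesis by (auto elim: eventually_mono)
    qed
    ultimately show ?thesis by (rule Lim_transform_eventually)
  qed
  moreover have "deriv h (of_real u) = of_real (Re (deriv h (of_real u)))" if "Im (deriv h (of_real u)) = 0"
    using that by (simp add: complex_eq_iff)
  ultimately show ?thesis
    using that[of "Re (deriv h (of_real u))"] by simp
qed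

section \<open>Cauchy transforms and Stieltjes inversion\<close>

text \<open>Every negative point has a null neighbourhood, and by the Lindelof property countably
  many null open sets cover the negative axis. All support conditions are handled in this
  almost-everywhere form below.\<close>

lemma measure_support_nonneg_iff:
  assumes "sets M = sets borel"
  shows "measure_support M \<subseteq> {0..} \<longleftrightarrow> (AE x in M. 0 \<le> x)"
proof
  assume supp: "measure_support M \<subseteq> {0..}"
  define \<F> where "\<F> = {B. open B \<and> emeasure M B = 0}"
  obtain \<F>' where \<F>': "\<F>' \<subseteq> \<F>" "countable \<F>'" "\<Union>\<F>' = \<Union>\<F>"
    using Lindelof[of \<F>] by (auto simp: \<F>_def)
  have "\<Union>\<F>' \<in> null_sets M"
    using \<F>' by (intro null_sets_UN'[of _ "\<lambda>x. x", simplified])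
      (auto simp: \<F>_def null_sets_def assms)
  moreover have "{..<0} \<subseteq> \<Union>\<F>"
  proof
    fix x :: real assume "x \<in> {..<0}"
    then have "x \<notin> measure_support M" using supp by auto
    then obtain e where "e > 0" "emeasure M (ball x e) = 0"
      by (auto simp: measure_support_def not_less)
    then show "x \<in> \<Union>\<F>" by (auto simp: \<F>_def intro!: exI[of _ "ball x e"])
  qed
  ultimately show "AE x in M. 0 \<le> x"
    using \<F>' by (intro AE_I'[of "\<Union>\<F>'"]) (auto simp: subset_eq)
next
  assume AE: "AE x in M. 0 \<le> x"
  show "measure_support M \<subseteq> {0..}"
  proof (rule ccontr)
    assume "\<not> ?thesis"
    then obtain x where x: "x \<in> measure_support M" "x < 0" by (auto simp: subset_eq not_le)
    \<comment> \<open>The radius \<open>-x\<close> is the largest for which the ball around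
      \<open>x\<close> stays inside the negative axis.\<close>
    have "emeasure M (ball x (-x)) = 0"
    proof -
      have "AE y in M. y \<notin> ball x (-x)" using AE by eventually_elim (auto simp: dist_real_def)
      then have "ball x (-x) \<in> null_sets M" by (subst AE_iff_null_sets) (auto simp: assms)
      then show ?thesis by (simp add: null_sets_def)
    qed
    moreover have "0 < emeasure M (ball x (-x))" using x by (simp add: measure_support_def)
    ultimately show False by simp
  qed
qed

section \<open>Cauchy transforms at points away from the mass\<close>

lemma cauchy_integrand_le:
  assumes "0 < d" "d \<le> norm (z - complex_of_real x)"
  shows "norm (1 / (z - complex_of_real x)) \<le> 1 / d"
  using assms by (simp add: norm_divide frac_le)

text \<open>The distance hypothesis covers two situations at once: \<open>d = Im z\<close> for any
  measure and \<open>z\<close> in the upper half-plane, and \<open>d = - Re z\<close> for a measure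
  on the nonnegative axis and \<open>z\<close> to the left of it.\<close>

lemma cauchy_integrable:
  assumes "finite_measure M" and sets: "sets M = sets borel"
    and "0 < d" and AE: "AE x in M. d \<le> norm (z - complex_of_real x)"
  shows "integrable M (\<lambda>x. 1 / (z - complex_of_real x))"
proof -
  interpret finite_measure M by fact
  note [measurable_cong] = sets
  show ?thesis
    by (rule integrable_const_bound[where B = "1 / d"])
       (use AE in eventually_elim, auto intro: cauchy_integrand_le[OF \<open>0 < d\<close>, simplified])
qed

text \<open>Differentiation under the integral, by dominated convergence of difference quotients
  along sequences. Staying within \<open>d/2\<close> of \<open>z\<close> keeps every denominator at
  least \<open>d/2\<close> in size, which gives a constant dominating function.\<close>

lemma cauchy_G_has_field_derivative:
  assumes fin: "finite_measure M" and sets: "sets M = sets borel"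
    and "0 < d" and AE: "AE x in M. d \<le> norm (z - complex_of_real x)"
  shows "(cauchy_G M has_field_derivative - (\<integral>x. 1 / (z - complex_of_real x)^2 \<partial>M)) (at z)"
proof -
  interpret finite_measure M by fact
  note [measurable_cong] = sets
  have "((\<lambda>w. (cauchy_G M w - cauchy_G M z) / (w - z)) \<longlongrightarrow> - (\<integral>x. 1 / (z - complex_of_real x)^2 \<partial>M))
          (at z within ball z (d/2))"
    unfolding tendsto_at_iff_sequentially
  proof (intro allI impI)
    fix X :: "nat \<Rightarrow> complex"
    assume X: "\<forall>i. X i \<in> ball z (d/2) - {z}" "X \<longlonglongrightarrow> z"
    have far: "d / 2 \<le> norm (X i - of_real x)" if "d \<le> norm (z - complex_of_real x)" for i x
    proof -
      have "norm (z - X i) < d / 2" using X(1) by (auto simp: dist_norm)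
      moreover have "norm (z - complex_of_real x) \<le> norm (z - X i) + norm (X i - of_real x)"
        using norm_triangle_ineq[of "z - X i" "X i - of_real x"] by simp
      ultimately show ?thesis using that by linarith
    qed
    have AE2: "AE x in M. d / 2 \<le> norm (X i - of_real x)" for i
      using AE by eventually_elim (rule far)
    have quot: "(cauchy_G M (X i) - cauchy_G M z) / (X i - z) =
        (\<integral>x. - (1 / ((X i - complex_of_real x) * (z - complex_of_real x))) \<partial>M)" for i
    proof -
      have "X i - z \<noteq> 0" using X(1) by auto
      have "(cauchy_G M (X i) - cauchy_G M z) / (X i - z) =
        (\<integral>x. (1 / (X i - complex_of_real x) - 1 / (z - complex_of_real x)) / (X i - z) \<partial>M)"
        unfolding cauchy_G_def
        by (subst Bochner_Integration.integral_diff[symmetric])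
           (use cauchy_integrable[OF fin sets _ AE2] cauchy_integrable[OF fin sets _ AE] \<open>0 < d\<close> in auto)
      also have "\<dots> = (\<integral>x. - (1 / ((X i - complex_of_real x) * (z - complex_of_real x))) \<partial>M)"
      proof (rule integral_cong_AE)
        show "AE x in M. (1 / (X i - complex_of_real x) - 1 / (z - complex_of_real x)) / (X i - z) =
            - (1 / ((X i - complex_of_real x) * (z - complex_of_real x)))"
          using AE2[of i] AE
        proof eventually_elim
          case (elim x)
          then have "X i - of_real x \<noteq> 0" "z - complex_of_real x \<noteq> 0" using \<open>0 < d\<close> by auto
          then show ?case using \<open>X i - z \<noteq> 0\<close> by (simp add: divide_simps)
        qed
      qed measurable
      finally show ?thesis .
    qed
    have "(\<lambda>i. \<integral>x. - (1 / ((X i - complex_of_real x) * (z - complex_of_real x))) \<partial>M) \<longlonglongrightarrow>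
        (\<integral>x. - (1 / (z - complex_of_real x)^2) \<partial>M)"
    proof (rule integral_dominated_convergence[where w = "\<lambda>_. 2 / d * (1 / d)"])
      show "AE x in M. (\<lambda>i. - (1 / ((X i - complex_of_real x) * (z - complex_of_real x)))) \<longlonglongrightarrow> - (1 / (z - complex_of_real x)^2)"
        using AE
      proof eventually_elim
        case (elim x)
        then have "z - complex_of_real x \<noteq> 0" using \<open>0 < d\<close> by auto
        then show ?case unfolding power2_eq_square using X(2) by (intro tendsto_intros) auto
      qed
      show "AE x in M. norm (- (1 / ((X i - complex_of_real x) * (z - complex_of_real x)))) \<le> 2 / d * (1 / d)" for i
        using AE2[of i] AE
      proof eventually_elim
        case (elim x)
        have "norm (1 / (X i - of_real x)) * norm (1 / (z - of_real x)) \<le> 1 / (d/2) * (1 / d)"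
          using elim \<open>0 < d\<close> by (intro mult_mono cauchy_integrand_le) auto
        then show ?case by (simp add: norm_mult norm_divide)
      qed
    qed auto
    then show "((\<lambda>w. (cauchy_G M w - cauchy_G M z) / (w - z)) \<circ> X) \<longlonglongrightarrow> - (\<integral>x. 1 / (z - complex_of_real x)^2 \<partial>M)"
      by (simp add: o_def quot)
  qed
  moreover have "at z within ball z (d/2) = at z"
    using \<open>0 < d\<close> by (intro at_within_open) auto
  ultimately show ?thesis by (simp add: has_field_derivative_iff)
qed

lemma norm_minus_of_real_ge_Im: "\<bar>Im z\<bar> \<le> norm (z - complex_of_real x)"
  using abs_Im_le_cmod[of "z - complex_of_real x"] by simp

lemma norm_minus_of_real_ge_neg:
  assumes "Re z < 0" "0 \<le> x"
  shows "- Re z \<le> norm (z - complex_of_real x)"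
  using abs_Re_le_cmod[of "z - complex_of_real x"] assms by simp

text \<open>The integrand is the Poisson kernel of the half-plane up to the factor pi, so boundary
  values of \<open>Im (cauchy_G M z)\<close> detect the mass of \<open>M\<close>.\<close>

lemma Im_cauchy_G:
  assumes "finite_measure M" "sets M = sets borel" "0 < Im z"
  shows "Im (cauchy_G M z) = - (\<integral>x. Im z / norm (z - complex_of_real x)^2 \<partial>M)"
    and "integrable M (\<lambda>x. Im z / norm (z - complex_of_real x)^2)"
proof -
  have int: "integrable M (\<lambda>x. 1 / (z - complex_of_real x))"
    by (rule cauchy_integrable[OF assms(1,2,3)]) (use norm_minus_of_real_ge_Im[of z] assms(3) in auto)
  have *: "Im (1 / (z - complex_of_real x)) = - (Im z / norm (z - complex_of_real x)^2)" for x
    unfolding cmod_power2 by (simp add: Im_divide)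
  show "Im (cauchy_G M z) = - (\<integral>x. Im z / norm (z - complex_of_real x)^2 \<partial>M)"
    unfolding cauchy_G_def integral_Im[OF int, symmetric] * by simp
  have "integrable M (\<lambda>x. Im (1 / (z - complex_of_real x)))" using int by simp
  then show "integrable M (\<lambda>x. Im z / norm (z - complex_of_real x)^2)" unfolding * by simp
qed

text \<open>A qualitative Stieltjes inversion: small Poisson integrals near \<open>u\<close> bound
  the mass of short intervals around \<open>u\<close> by \<open>e\<close> times their length, and
  bisection extends this to every interval in the negative axis. The limit is taken in the whole
  half-plane because the test point lies above the midpoint of the interval and not above
  \<open>u\<close>.\<close>

lemma AE_nonneg_of_boundary_limit:
  assumes "finite_measure M" and sets: "sets M = sets borel"
    and lim: "\<And>u. u < 0 \<Longrightarrow> ((\<lambda>z. \<integral>x. Im z / norm (z - complex_of_real x)^2 \<partial>M) \<longlongrightarrow> 0)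
                 (at (complex_of_real u) within {z. 0 < Im z})"
  shows "AE x in M. 0 \<le> x"
proof -
  interpret finite_measure M by fact
  note [measurable_cong] = sets
  \<comment> \<open>Bolzano's bisection principle reduces the bound to short intervals around each
    point. Half-open intervals make concatenation a disjoint union, so both sides are
    additive.\<close>
  have le: "measure M {a<..b} \<le> e * (b - a)" if "a \<le> b" "b < 0" "0 < e" for a b e
    using that(1,2)
  proof (induction rule: Bolzano)
    case (trans a b c)
    have "measure M {a<..c} = measure M ({a<..b} \<union> {b<..c})"
      using trans by (intro arg_cong[where f = "measure M"]) auto
    also have "\<dots> = measure M {a<..b} + measure M {b<..c}"
      by (rule finite_measure_Union) (auto simp: sets)
    finally show ?case using trans by (simp add: algebra_simps)
  next
    case (local u)
    then have "u < 0" using \<open>b < 0\<close> by simp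
    from tendstoD[OF lim[OF this] \<open>0 < e\<close>]
    obtain d where d: "0 < d" "\<And>z. \<lbrakk>0 < Im z; z \<noteq> of_real u; norm (z - of_real u) < d\<rbrakk> \<Longrightarrow>
        \<bar>\<integral>x. Im z / norm (z - complex_of_real x)^2 \<partial>M\<bar> < e"
      unfolding eventually_at by (auto simp: dist_norm)
    show ?case
    proof (intro exI conjI allI impI)
      fix p q assume pq: "p \<le> u \<and> u \<le> q \<and> q - p < d"
      show "measure M {p<..q} \<le> e * (q - p)"
      proof (cases "p = q")
        case False
        \<comment> \<open>the Poisson kernel at \<open>(p + q)/2 + i (q - p)/2\<close> is at least \<open>1/(q - p)\<close> on \<open>{p<..q}\<close>\<close>
        define y where "y = (q - p) / 2"
        define z where "z = Complex ((p + q) / 2) y"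
        have y: "0 < y" using pq False by (simp add: y_def)
        then have z: "0 < Im z" "z \<noteq> of_real u" by (auto simp: z_def complex_eq_iff)
        \<comment> \<open>Both the horizontal distance from \<open>u\<close> to the midpoint and the
          height \<open>y\<close> are at most \<open>(q - p) / 2\<close>, and
          \<open>q - p < d\<close>.\<close>
        have "norm (z - of_real u) \<le> \<bar>(p + q) / 2 - u\<bar> + \<bar>y\<bar>"
          using cmod_le[of "z - of_real u"] by (simp add: z_def)
        also have "\<dots> < d" using pq y by (auto simp: y_def abs_if field_simps)
        finally have less: "\<bar>\<integral>x. Im z / norm (z - complex_of_real x)^2 \<partial>M\<bar> < e" using d z by blast
        have "measure M {p<..q} / (2 * y) = (\<integral>x. indicator {p<..q} x / (2 * y) \<partial>M)"
          by (simp add: sets sets_eq_imp_space_eq[OF sets])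
        also have "\<dots> \<le> (\<integral>x. Im z / norm (z - complex_of_real x)^2 \<partial>M)"
        proof (rule integral_mono)
          show "integrable M (\<lambda>x. Im z / norm (z - complex_of_real x)^2)"
            by (rule Im_cauchy_G(2)[OF assms(1,2) z(1)])
          show "integrable M (\<lambda>x. indicator {p<..q} x / (2 * y))"
            by (intro integrable_divide integrable_real_indicator) (auto simp: sets emeasure_finite less_top[symmetric])
          fix x
          show "indicator {p<..q} x / (2 * y) \<le> Im z / norm (z - complex_of_real x)^2"
          proof (cases "x \<in> {p<..q}")
            case True
            then have "\<bar>(p + q) / 2 - x\<bar> \<le> y" by (auto simp: y_def abs_if field_simps)
            then have "((p + q) / 2 - x)^2 \<le> y^2" using abs_le_square_iff y by fastforce
            then have "norm (z - complex_of_real x)^2 \<le> 2 * y^2"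
              unfolding cmod_power2 by (simp add: z_def)
            moreover have "norm (z - complex_of_real x)^2 > 0" using z(1) by (auto simp: complex_eq_iff)
            ultimately have "y / (2 * y^2) \<le> y / norm (z - complex_of_real x)^2"
              using y by (intro divide_left_mono) auto
            then show ?thesis using True y by (simp add: z_def power2_eq_square)
          next
            case False
            then show ?thesis using z(1) by simp
          qed
        qed
        also have "\<dots> < e" using less by simp
        finally show ?thesis using y by (simp add: y_def field_simps)
      qed simp
    qed (rule \<open>0 < d\<close>)
  qed
  have null: "{a<..b} \<in> null_sets M" if "b < 0" for a b
  proof (cases "a \<le> b")
    case True
    have "measure M {a<..b} \<le> 0 + e" if "0 < e" for e
    proof -
      \<comment> \<open>The extra 1 in the denominator keeps the quotient meaningful when
        \<open>a = b\<close>.\<close>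
      have "measure M {a<..b} \<le> (e / (b - a + 1)) * (b - a)"
        using le[OF True \<open>b < 0\<close>, of "e / (b - a + 1)"] True that by simp
      also have "\<dots> \<le> e" using True that by (simp add: field_simps)
      finally show ?thesis by simp
    qed
    then have "measure M {a<..b} \<le> 0" by (rule field_le_epsilon)
    then show ?thesis by (auto simp: null_sets_def sets emeasure_eq_measure measure_le_0_iff)
  qed auto
  \<comment> \<open>Countably many intervals with right endpoint strictly below 0 exhaust the
    negative axis.\<close>
  have "(\<Union>n. {- real n<..- (1 / real (Suc n))}) \<in> null_sets M"
    by (rule null_sets_UN) (rule null, simp)
  moreover have "x \<in> (\<Union>n. {- real n<..- (1 / real (Suc n))})" if "x < 0" for x
  proof -
    obtain n where n: "max (- x) (1 / - x) < real n" using reals_Archimedean2 by blast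
    then have "1 < real (Suc n) * - x" using that by (auto simp: field_simps)
    then have "x \<in> {- real n<..- (1 / real (Suc n))}" using n by (auto simp: field_simps)
    then show ?thesis by blast
  qed
  ultimately show ?thesis by (intro AE_I') (auto simp: not_le)
qed

section \<open>The reciprocal Cauchy transform and the vector field\<close>

lemma AE_Im_le_norm: "AE x in M. Im z \<le> norm (z - complex_of_real x)"
  using norm_minus_of_real_ge_Im[of z] by (auto intro: order_trans[OF abs_ge_self])

text \<open>A strictly positive function has strictly positive integral against a probability
  measure. Strictness also excludes zeros of \<open>cauchy_G\<close>, at which
  \<open>recip_H\<close> would take the default value 0.\<close>

lemma Im_cauchy_G_neg:
  assumes "prob_space M" "sets M = sets borel" "0 < Im z"
  shows "Im (cauchy_G M z) < 0"
proof -
  interpret prob_space M by fact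
  note fin = finite_measure_axioms
  have pos: "0 < Im z / norm (z - complex_of_real x)^2" for x
    using assms(3) by (auto simp: complex_eq_iff)
  have "0 < (\<integral>x. Im z / norm (z - complex_of_real x)^2 \<partial>M)"
    by (rule expectation_greater[OF Im_cauchy_G(2)[OF fin assms(2,3)]]) (simp add: pos)
  then show ?thesis by (simp add: Im_cauchy_G(1)[OF fin assms(2,3)])
qed

lemma Im_inverse_neg: "Im (1 / w) = - Im w / norm w ^ 2" for w :: complex
  unfolding cmod_power2 by (simp add: Im_divide)

lemma Im_recip_H_pos:
  assumes "prob_space M" "sets M = sets borel" "0 < Im z"
  shows "0 < Im (recip_H M z)"
proof -
  have "Im (cauchy_G M z) < 0" by (rule Im_cauchy_G_neg[OF assms])
  moreover from this have "cauchy_G M z \<noteq> 0" by auto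
  ultimately show ?thesis by (simp add: recip_H_def Im_inverse_neg divide_neg_pos)
qed

lemma recip_H_holomorphic:
  assumes "prob_space M" "sets M = sets borel"
  shows "recip_H M holomorphic_on {z. 0 < Im z}"
proof -
  interpret prob_space M by fact
  have "cauchy_G M holomorphic_on {z. 0 < Im z}"
    unfolding holomorphic_on_def field_differentiable_def
    using cauchy_G_has_field_derivative[OF finite_measure_axioms assms(2) _ AE_Im_le_norm]
      has_field_derivative_at_within by blast
  moreover have "cauchy_G M z \<noteq> 0" if "0 < Im z" for z
    using Im_cauchy_G_neg[OF assms that] by auto
  ultimately show ?thesis
    unfolding recip_H_def[abs_def] by (intro holomorphic_intros) auto
qed

lemma AE_neg_le_norm:
  assumes "AE x in M. 0 \<le> x" "Re z < 0"
  shows "AE x in M. - Re z \<le> norm (z - complex_of_real x)"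
  using assms(1) by eventually_elim (rule norm_minus_of_real_ge_neg[OF assms(2)])

text \<open>For \<open>x \<ge> 0\<close> one has \<open>1 / u \<le> 1 / (u - x) < 0\<close>.
  Averaging over a measure of mass one keeps these inequalities, and taking reciprocals of negative
  numbers reverses the first.\<close>

lemma recip_H_negative_axis:
  fixes u :: real
  assumes "prob_space M" and sets: "sets M = sets borel" and AE: "AE x in M. 0 \<le> x" and "u < 0"
  obtains h where "h \<le> u" "recip_H M (of_real u) = of_real h" "isCont (recip_H M) (of_real u)"
    "cauchy_G M (of_real u) \<noteq> 0"
proof -
  interpret prob_space M by fact
  note [measurable_cong] = sets
  note fin = finite_measure_axioms
  have AEd: "AE x in M. - u \<le> norm (complex_of_real u - of_real x)"
    using AE_neg_le_norm[OF AE, of "of_real u"] \<open>u < 0\<close> by simp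
  have int: "integrable M (\<lambda>x. 1 / (u - x))"
    by (rule integrable_const_bound[where B = "1 / - u"])
       (use AE in eventually_elim, use \<open>u < 0\<close> in \<open>auto simp: divide_simps abs_if\<close>)
  define g where "g = (\<integral>x. 1 / (u - x) \<partial>M)"
  have G: "cauchy_G M (of_real u) = of_real g"
    unfolding g_def cauchy_G_def integral_complex_of_real[symmetric] by simp
  have "g < 0"
    unfolding g_def using AE by (intro expectation_less[OF int]) (use \<open>u < 0\<close> in \<open>auto elim!: eventually_mono\<close>)
  have "1 / u = (\<integral>x. 1 / u \<partial>M)" by (simp add: prob_space)
  also have "\<dots> \<le> g" unfolding g_def
  proof (rule integral_mono_AE[OF _ int])
    show "AE x in M. 1 / u \<le> 1 / (u - x)"
      using AE by eventually_elim (use \<open>u < 0\<close> in \<open>simp add: divide_simps\<close>)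
  qed simp
  finally have "1 / g \<le> u" using \<open>g < 0\<close> \<open>u < 0\<close> by (simp add: divide_simps mult.commute)
  moreover have "recip_H M (of_real u) = of_real (1 / g)" by (simp add: recip_H_def G)
  moreover have nz: "cauchy_G M (of_real u) \<noteq> 0" using G \<open>g < 0\<close> by simp
  moreover have "isCont (cauchy_G M) (of_real u)"
    using cauchy_G_has_field_derivative[OF fin sets _ AEd] \<open>u < 0\<close> DERIV_isCont by force
  then have "isCont (recip_H M) (of_real u)"
    unfolding recip_H_def[abs_def] using nz by (intro continuous_intros)
  ultimately show ?thesis using that by blast
qed

text \<open>\<open>Im H\<close> is \<open>- Im G\<close> times the square of \<open>norm H\<close>,
  for \<open>H = recip_H M\<close> and \<open>G = cauchy_G M\<close>. Near \<open>u\<close> the norm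
  of \<open>H\<close> is bounded by continuity, and \<open>- Im G\<close> is at most a multiple of
  \<open>Im z\<close> because \<open>z\<close> stays away from the mass of \<open>M\<close>.\<close>

lemma Im_recip_H_le_near_negative_axis:
  fixes u :: real
  assumes "prob_space M" and sets: "sets M = sets borel" and AE: "AE x in M. 0 \<le> x" and "u < 0"
  obtains r C where "0 < r" "\<And>z. \<lbrakk>0 < Im z; norm (z - of_real u) < r\<rbrakk> \<Longrightarrow> Im (recip_H M z) \<le> C * Im z"
proof -
  interpret prob_space M by fact
  note [measurable_cong] = sets
  note fin = finite_measure_axioms
  from recip_H_negative_axis[OF assms] obtain h where
    h: "isCont (recip_H M) (of_real u)" "cauchy_G M (of_real u) \<noteq> 0" by metis
  define B where "B = norm (recip_H M (of_real u)) + 1"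
  from h(1) have "((\<lambda>z. norm (recip_H M z)) \<longlongrightarrow> norm (recip_H M (of_real u))) (at (of_real u))"
    unfolding isCont_def by (intro tendsto_intros)
  then have "\<forall>\<^sub>F z in at (of_real u). norm (recip_H M z) < B"
    by (rule order_tendstoD) (simp add: B_def)
  then obtain r where r: "0 < r" "\<And>z. \<lbrakk>z \<noteq> of_real u; norm (z - of_real u) < r\<rbrakk> \<Longrightarrow> norm (recip_H M z) < B"
    unfolding eventually_at by (auto simp: dist_norm)
  \<comment> \<open>The radius \<open>- u/2\<close> keeps \<open>Re z\<close> below
    \<open>u/2\<close>, hence \<open>z\<close> at distance at least \<open>- u/2\<close> from the
    nonnegative axis.\<close>
  have "Im (recip_H M z) \<le> (B^2 / (u/2)^2) * Im z" if z: "0 < Im z" "norm (z - of_real u) < min r (- u/2)" for z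
  proof -
    have "\<bar>Re z - u\<bar> < - u/2" using z abs_Re_le_cmod[of "z - of_real u"] by simp
    then have Re: "Re z < u/2" by (simp add: abs_if split: if_splits)
    then have Re0: "Re z < 0" using \<open>u < 0\<close> by simp
    have "- Im (cauchy_G M z) = (\<integral>x. Im z / norm (z - complex_of_real x)^2 \<partial>M)"
      using Im_cauchy_G(1)[OF fin sets z(1)] by simp
    also have "\<dots> \<le> (\<integral>x. Im z / (u/2)^2 \<partial>M)"
    proof (rule integral_mono_AE[OF Im_cauchy_G(2)[OF fin sets z(1)]])
      show "AE x in M. Im z / norm (z - complex_of_real x)^2 \<le> Im z / (u/2)^2"
        using AE_neg_le_norm[OF AE Re0]
      proof eventually_elim
        case (elim x)
        then have "- (u/2) \<le> norm (z - complex_of_real x)" using Re by simp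
        then have "(- (u/2))^2 \<le> norm (z - complex_of_real x)^2"
          using \<open>u < 0\<close> by (intro power_mono) auto
        then show ?case using z(1) \<open>u < 0\<close> by (intro divide_left_mono mult_pos_pos) (auto simp: complex_eq_iff)
      qed
    qed simp
    also have "\<dots> = Im z / (u/2)^2" by (simp add: prob_space)
    finally have "- Im (cauchy_G M z) * norm (recip_H M z)^2 \<le> Im z / (u/2)^2 * B^2"
    proof (rule mult_mono)
      have "norm (recip_H M z) < B" using z by (intro r(2)) auto
      then show "norm (recip_H M z)^2 \<le> B^2" by (intro power_mono) auto
    qed (use z in auto)
    moreover have "Im (recip_H M z) = - Im (cauchy_G M z) * norm (recip_H M z)^2"
      by (simp add: recip_H_def Im_inverse_neg norm_divide power_divide)
    ultimately show ?thesis by (simp add: mult.commute)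
  qed
  moreover have "0 < min r (- u/2)" using r(1) \<open>u < 0\<close> by simp
  ultimately show ?thesis using that by blast
qed

text \<open>The kernel equals \<open>z - (1 + z^2) / (z - x)\<close>, so regularity of the field,
  also on the negative axis when \<tau> has no mass there, is inherited from the Cauchy
  transform.\<close>

lemma monotone_field_eq:
  assumes "finite_measure \<tau>" and sets: "sets \<tau> = sets borel"
    and "0 < d" and AE: "AE x in \<tau>. d \<le> norm (z - complex_of_real x)"
  shows "monotone_field \<gamma> \<tau> z = - of_real \<gamma> + of_real (measure \<tau> UNIV) * z - (1 + z^2) * cauchy_G \<tau> z"
    and "integrable \<tau> (\<lambda>x. (1 + complex_of_real x * z) / (complex_of_real x - z))"
proof -
  interpret finite_measure \<tau> by fact
  note [measurable_cong] = sets
  note int = cauchy_integrable[OF assms]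
  have eq: "AE x in \<tau>. (1 + complex_of_real x * z) / (complex_of_real x - z) = z - (1 + z^2) * (1 / (z - complex_of_real x))"
    using AE
  proof eventually_elim
    case (elim x)
    then have "z - complex_of_real x \<noteq> 0" "complex_of_real x - z \<noteq> 0" using \<open>0 < d\<close> by auto
    then show ?case by (simp add: divide_simps power2_eq_square) (simp add: algebra_simps)
  qed
  have int': "integrable \<tau> (\<lambda>x. z - (1 + z^2) * (1 / (z - complex_of_real x)))"
    using int by (intro Bochner_Integration.integrable_diff integrable_mult_right) auto
  show "integrable \<tau> (\<lambda>x. (1 + complex_of_real x * z) / (complex_of_real x - z))"
    by (subst integrable_cong_AE[OF _ _ eq]) (use int' in auto)
  have "(\<integral>x. (1 + complex_of_real x * z) / (complex_of_real x - z) \<partial>\<tau>) =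
      (\<integral>x. z - (1 + z^2) * (1 / (z - complex_of_real x)) \<partial>\<tau>)"
    by (rule integral_cong_AE[OF _ _ eq]) auto
  also have "\<dots> = (\<integral>x. z \<partial>\<tau>) - (\<integral>x. (1 + z^2) * (1 / (z - complex_of_real x)) \<partial>\<tau>)"
    using int by (intro Bochner_Integration.integral_diff integrable_mult_right) auto
  also have "\<dots> = of_real (measure \<tau> UNIV) * z - (1 + z^2) * cauchy_G \<tau> z"
    using sets_eq_imp_space_eq[OF sets] integral_mult_right_zero[of \<tau> "1 + z^2" "\<lambda>x. 1 / (z - complex_of_real x)"]
    by (simp only: cauchy_G_def) (simp add: scaleR_conv_of_real)
  finally show "monotone_field \<gamma> \<tau> z = - of_real \<gamma> + of_real (measure \<tau> UNIV) * z - (1 + z^2) * cauchy_G \<tau> z"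
    by (simp add: monotone_field_def)
qed

section \<open>Sign and growth of the real and imaginary parts of the field\<close>

lemma Im_monotone_integrand:
  "Im ((1 + complex_of_real x * z) / (complex_of_real x - z)) = (1 + x^2) * (Im z / norm (z - complex_of_real x)^2)"
  unfolding cmod_power2 by (simp add: Im_divide) (simp add: power2_eq_square algebra_simps)

text \<open>The bound is the value of the kernel at \<open>z = 0\<close>.\<close>

lemma Re_monotone_integrand_le:
  assumes "0 < x" "Re z \<le> 0" "Im z \<noteq> 0"
  shows "Re ((1 + complex_of_real x * z) / (complex_of_real x - z)) \<le> 1 / x"
proof -
  define D where "D = (x - Re z)^2 + (Im z)^2"
  have D: "0 < D" using assms by (simp add: D_def sum_power2_gt_zero_iff)
  have Re: "Re ((1 + complex_of_real x * z) / (complex_of_real x - z)) = ((1 + x * Re z) * (x - Re z) - x * (Im z)^2) / D"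
    by (simp add: Re_divide D_def power2_eq_square)
  \<comment> \<open>This product is exactly \<open>x\<close> times the numerator of the real part,
    minus \<open>D\<close>.\<close>
  have "(1 + x^2) * (Re z * (x - Re z) - (Im z)^2) \<le> 0"
  proof (rule mult_nonneg_nonpos)
    have "Re z * (x - Re z) \<le> 0" using assms by (intro mult_nonpos_nonneg) auto
    then show "Re z * (x - Re z) - (Im z)^2 \<le> 0" using zero_le_power2[of "Im z"] by linarith
  qed simp
  then have "x * ((1 + x * Re z) * (x - Re z) - x * (Im z)^2) \<le> D"
    by (simp add: D_def power2_eq_square algebra_simps)
  then show ?thesis unfolding Re using D assms(1) by (simp add: divide_simps mult.commute)
qed

lemma Im_monotone_field:
  assumes fin: "finite_measure \<tau>" and sets: "sets \<tau> = sets borel" and z: "0 < Im z"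
  shows "Im (monotone_field \<gamma> \<tau> z) = (\<integral>x. (1 + x^2) * (Im z / norm (z - complex_of_real x)^2) \<partial>\<tau>)"
    and "integrable \<tau> (\<lambda>x. (1 + x^2) * (Im z / norm (z - complex_of_real x)^2))"
proof -
  note int = monotone_field_eq(2)[OF fin sets z AE_Im_le_norm]
  show "Im (monotone_field \<gamma> \<tau> z) = (\<integral>x. (1 + x^2) * (Im z / norm (z - complex_of_real x)^2) \<partial>\<tau>)"
    unfolding Im_monotone_integrand[symmetric] using integral_Im[OF int] by (simp add: monotone_field_def)
  show "integrable \<tau> (\<lambda>x. (1 + x^2) * (Im z / norm (z - complex_of_real x)^2))"
    unfolding Im_monotone_integrand[symmetric] using int by simp
qed

lemma Im_monotone_field_nonneg:
  assumes "finite_measure \<tau>" "sets \<tau> = sets borel" "0 < Im z"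
  shows "0 \<le> Im (monotone_field \<gamma> \<tau> z)"
  unfolding Im_monotone_field(1)[OF assms] using assms(3) by (intro integral_nonneg_AE) auto

text \<open>The weight \<open>1 + x^2\<close> is at least 1. Hence vanishing boundary values of
  \<open>Im A\<close> allow Stieltjes inversion for \<tau> itself.\<close>

lemma poisson_le_Im_monotone_field:
  assumes "finite_measure \<tau>" "sets \<tau> = sets borel" "0 < Im z"
  shows "(\<integral>x. Im z / norm (z - complex_of_real x)^2 \<partial>\<tau>) \<le> Im (monotone_field \<gamma> \<tau> z)"
  unfolding Im_monotone_field(1)[OF assms]
proof (rule integral_mono[OF Im_cauchy_G(2)[OF assms] Im_monotone_field(2)[OF assms]])
  fix x
  have "1 * (Im z / norm (z - complex_of_real x)^2) \<le> (1 + x^2) * (Im z / norm (z - complex_of_real x)^2)"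
    using assms(3) by (intro mult_right_mono) auto
  then show "Im z / norm (z - complex_of_real x)^2 \<le> (1 + x^2) * (Im z / norm (z - complex_of_real x)^2)" by simp
qed

text \<open>For \<open>x \<ge> 0\<close> the squared distance from \<open>z\<close> to
  \<open>x\<close> is at least \<open>(x + a)^2 \<ge> x^2 + a^2\<close>, which absorbs the weight
  \<open>1 + x^2\<close>. The result is linear in \<open>Im z\<close>, as a Gronwall argument
  needs.\<close>

lemma Im_monotone_field_le:
  assumes fin: "finite_measure \<tau>" and sets: "sets \<tau> = sets borel" and AE: "AE x in \<tau>. 0 \<le> x"
    and z: "0 < Im z" "Re z \<le> - a" "0 < a"
  shows "Im (monotone_field \<gamma> \<tau> z) \<le> (1 + 1 / a^2) * measure \<tau> UNIV * Im z"
proof -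
  interpret finite_measure \<tau> by fact
  have "Im (monotone_field \<gamma> \<tau> z) \<le> (\<integral>x. (1 + 1 / a^2) * Im z \<partial>\<tau>)"
    unfolding Im_monotone_field(1)[OF fin sets z(1)]
  proof (rule integral_mono_AE[OF Im_monotone_field(2)[OF fin sets z(1)]])
    show "AE x in \<tau>. (1 + x^2) * (Im z / norm (z - complex_of_real x)^2) \<le> (1 + 1 / a^2) * Im z"
      using AE
    proof eventually_elim
      case (elim x)
      have "1 + x^2 \<le> (1 + 1 / a^2) * (x^2 + a^2)"
        using z(3) by (simp add: field_simps)
      also have "\<dots> \<le> (1 + 1 / a^2) * norm (z - complex_of_real x)^2"
      proof (rule mult_left_mono)
        have "x^2 + a^2 \<le> (x + a)^2" using elim z(3) by (simp add: power2_sum)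
        also have "\<dots> \<le> (x - Re z)^2" using elim z by (intro power_mono) auto
        also have "\<dots> \<le> norm (z - complex_of_real x)^2"
          unfolding cmod_power2 by (simp add: power2_commute)
        finally show "x^2 + a^2 \<le> norm (z - complex_of_real x)^2" .
      qed simp
      finally have "(1 + x^2) * Im z \<le> (1 + 1 / a^2) * norm (z - complex_of_real x)^2 * Im z"
        using z(1) by (intro mult_right_mono) auto
      moreover have "0 < norm (z - complex_of_real x)^2" using z(1) by (auto simp: complex_eq_iff)
      ultimately show ?case by (simp add: pos_divide_le_eq mult_ac)
    qed
  qed simp
  then show ?thesis using sets_eq_imp_space_eq[OF sets] by (simp add: mult_ac)
qed

text \<open>Integrating the pointwise bound \<open>1 / x\<close> shows that the drift \<gamma>
  dominates the integral part. This makes the flow move left as long as it is in the left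
  half-plane.\<close>

lemma Re_monotone_field_nonpos:
  assumes fin: "finite_measure \<tau>" and sets: "sets \<tau> = sets borel" and AE: "AE x in \<tau>. 0 < x"
    and int: "set_integrable \<tau> {0<..} (\<lambda>x. 1 / x)" and \<gamma>: "(\<integral>x\<in>{0<..}. 1 / x \<partial>\<tau>) \<le> \<gamma>"
    and z: "0 < Im z" "Re z \<le> 0"
  shows "Re (monotone_field \<gamma> \<tau> z) \<le> 0"
proof -
  note intA = monotone_field_eq(2)[OF fin sets z(1) AE_Im_le_norm]
  have "(\<integral>x. Re ((1 + complex_of_real x * z) / (complex_of_real x - z)) \<partial>\<tau>) \<le> (\<integral>x\<in>{0<..}. 1 / x \<partial>\<tau>)"
    unfolding set_lebesgue_integral_def
  proof (rule integral_mono_AE)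
    show "integrable \<tau> (\<lambda>x. Re ((1 + complex_of_real x * z) / (complex_of_real x - z)))" using intA by simp
    show "integrable \<tau> (\<lambda>x. indicator {0<..} x *\<^sub>R (1 / x))" using int by (simp add: set_integrable_def)
    show "AE x in \<tau>. Re ((1 + complex_of_real x * z) / (complex_of_real x - z)) \<le> indicator {0<..} x *\<^sub>R (1 / x)"
      using AE by eventually_elim (use Re_monotone_integrand_le[of _ z] z in simp)
  qed
  then show ?thesis using \<gamma> integral_Re[OF intA] by (simp add: monotone_field_def)
qed

text \<open>The closed form in \<open>monotone_field_eq\<close> is valid both in the upper
  half-plane and at \<open>u\<close>, and it is continuous at \<open>u\<close>.\<close>

lemma monotone_field_boundary_limit:
  fixes u :: real
  assumes fin: "finite_measure \<tau>" and sets: "sets \<tau> = sets borel" and AE: "AE x in \<tau>. 0 \<le> x" and "u < 0"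
  shows "(monotone_field \<gamma> \<tau> \<longlongrightarrow> of_real (- \<gamma> + (\<integral>x. (1 + x * u) / (x - u) \<partial>\<tau>))) (at (of_real u) within {z. 0 < Im z})"
proof -
  have AEd: "AE x in \<tau>. - u \<le> norm (complex_of_real u - of_real x)"
    using AE_neg_le_norm[OF AE, of "of_real u"] \<open>u < 0\<close> by simp
  have "0 < - u" using \<open>u < 0\<close> by simp
  define f where "f = (\<lambda>z. - of_real \<gamma> + of_real (measure \<tau> UNIV) * z - (1 + z^2) * cauchy_G \<tau> z)"
  have "isCont (cauchy_G \<tau>) (of_real u)"
    using cauchy_G_has_field_derivative[OF fin sets \<open>0 < - u\<close> AEd] DERIV_isCont by force
  then have "isCont f (of_real u)" unfolding f_def by (intro continuous_intros)
  then have "(f \<longlongrightarrow> f (of_real u)) (at (of_real u) within {z. 0 < Im z})"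
    by (meson isCont_def tendsto_within_subset subset_UNIV)
  moreover have "\<forall>\<^sub>F z in at (of_real u) within {z. 0 < Im z}. f z = monotone_field \<gamma> \<tau> z"
    unfolding eventually_at_filter f_def
    using monotone_field_eq(1)[OF fin sets _ AE_Im_le_norm] by (intro always_eventually) auto
  ultimately have "(monotone_field \<gamma> \<tau> \<longlongrightarrow> f (of_real u)) (at (of_real u) within {z. 0 < Im z})"
    by (rule Lim_transform_eventually)
  moreover have "f (of_real u) = monotone_field \<gamma> \<tau> (of_real u)"
    unfolding f_def by (rule monotone_field_eq(1)[OF fin sets \<open>0 < - u\<close> AEd, symmetric])
  moreover have "\<dots> = of_real (- \<gamma> + (\<integral>x. (1 + x * u) / (x - u) \<partial>\<tau>))"
    unfolding monotone_field_def of_real_add integral_complex_of_real[symmetric] by simp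
  ultimately show ?thesis by simp
qed

section \<open>The flow when the third condition holds\<close>

text \<open>Time derivatives of the flow live within \<open>{0..}\<close>. At interior times they
  are ordinary derivatives; at the endpoints only continuity is used.\<close>

lemma nondecreasing_of_deriv_within:
  fixes f f' :: "real \<Rightarrow> real"
  assumes "0 \<le> a" "a \<le> b"
    and deriv: "\<And>t. \<lbrakk>a \<le> t; t \<le> b\<rbrakk> \<Longrightarrow> (f has_real_derivative f' t) (at t within {0..})"
    and nonneg: "\<And>t. \<lbrakk>a < t; t < b\<rbrakk> \<Longrightarrow> 0 \<le> f' t"
  shows "f a \<le> f b"
proof (rule DERIV_nonneg_imp_increasing_open[OF \<open>a \<le> b\<close>])
  fix t assume t: "a < t" "t < b"
  then have "at t within {0..} = at t"
    using \<open>0 \<le> a\<close> by (intro at_within_interior) auto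
  then show "\<exists>y. (f has_real_derivative y) (at t) \<and> 0 \<le> y"
    using deriv[of t] nonneg t by auto
next
  show "continuous_on {a..b} f"
    unfolding continuous_on_eq_continuous_within
  proof
    fix t assume "t \<in> {a..b}"
    then show "continuous (at t within {a..b}) f"
      using \<open>0 \<le> a\<close> by (intro continuous_within_subset[OF DERIV_continuous[OF deriv]]) auto
  qed
qed

text \<open>As long as \<open>f \<le> 0\<close> it cannot increase. At a first time with
  \<open>f \<ge> 0\<close> it would therefore still be at most \<open>f 0 < 0\<close>.\<close>

lemma negative_barrier:
  fixes f f' :: "real \<Rightarrow> real"
  assumes "0 \<le> T" and "f 0 < 0"
    and deriv: "\<And>t. 0 \<le> t \<Longrightarrow> (f has_real_derivative f' t) (at t within {0..})"
    and nonpos: "\<And>t. \<lbrakk>0 \<le> t; f t \<le> 0\<rbrakk> \<Longrightarrow> f' t \<le> 0"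
  shows "f T \<le> f 0"
proof -
  have step: "f s \<le> f 0" if s: "0 \<le> s" "\<And>t. \<lbrakk>0 < t; t < s\<rbrakk> \<Longrightarrow> f t \<le> 0" for s
  proof -
    have "- f 0 \<le> - f s"
      by (rule nondecreasing_of_deriv_within[where f' = "\<lambda>t. - f' t"])
         (use s nonpos in \<open>auto intro!: DERIV_minus deriv\<close>)
    then show ?thesis by simp
  qed
  have "f t < 0" if "0 \<le> t" for t
  proof (rule ccontr)
    assume "\<not> f t < 0"
    \<comment> \<open>The infimum of \<open>S\<close> is the first time at which \<open>f\<close> is
      nonnegative; closedness of \<open>S\<close> puts it in \<open>S\<close>.\<close>
    define S where "S = {s \<in> {0..t}. 0 \<le> f s}"
    have "continuous_on {0..t} f"
      unfolding continuous_on_eq_continuous_within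
      by (auto intro!: continuous_within_subset[OF DERIV_continuous[OF deriv]])
    then have "closed S" unfolding S_def by (intro continuous_on_closed_Collect_le continuous_on_const) auto
    moreover have ne: "t \<in> S" using \<open>\<not> f t < 0\<close> that by (simp add: S_def)
    moreover have bdd: "bdd_below S" by (rule bdd_belowI[of _ 0]) (simp add: S_def)
    ultimately have Inf: "Inf S \<in> S" using closed_contains_Inf by blast
    have "f s \<le> 0" if "0 < s" "s < Inf S" for s
    proof (rule ccontr)
      assume "\<not> f s \<le> 0"
      then have "s \<in> S" using that Inf by (auto simp: S_def)
      then show False using cInf_lower[OF _ bdd, of s] that by simp
    qed
    then have "f (Inf S) \<le> f 0" using Inf by (intro step) (auto simp: S_def)
    then show False using Inf \<open>f 0 < 0\<close> by (simp add: S_def)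
  qed
  then show ?thesis using \<open>0 \<le> T\<close> by (intro step) (auto intro: less_imp_le)
qed

section \<open>The flow started in the upper left quadrant\<close>

lemma monotone_semigroupD:
  assumes "monotone_semigroup \<mu>" "0 \<le> t"
  shows "prob_space (\<mu> t)" "sets (\<mu> t) = sets borel" "finite_measure (\<mu> t)"
  using assms by (auto simp: monotone_semigroup_def prob_space.finite_measure)

lemma associated_pairD:
  assumes "associated_pair \<mu> \<gamma> \<tau>"
  shows "finite_measure \<tau>" "sets \<tau> = sets borel"
    and "0 < Im z \<Longrightarrow> recip_H (\<mu> 0) z = z"
    and "\<lbrakk>0 < Im z; 0 \<le> t\<rbrakk> \<Longrightarrow> ((\<lambda>s. recip_H (\<mu> s) z) has_vector_derivative
           monotone_field \<gamma> \<tau> (recip_H (\<mu> t) z)) (at t within {0..})"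
  using assms by (auto simp: associated_pair_def)

lemma has_vector_derivative_Re:
  "(f has_vector_derivative f') F \<Longrightarrow> ((\<lambda>x. Re (f x)) has_real_derivative Re f') F"
  unfolding has_real_derivative_iff_has_vector_derivative
  by (rule bounded_linear.has_vector_derivative[OF bounded_linear_Re])

lemma has_vector_derivative_Im:
  "(f has_vector_derivative f') F \<Longrightarrow> ((\<lambda>x. Im (f x)) has_real_derivative Im f') F"
  unfolding has_real_derivative_iff_has_vector_derivative
  by (rule bounded_linear.has_vector_derivative[OF bounded_linear_Im])

lemma Im_recip_H_mono:
  assumes ms: "monotone_semigroup \<mu>" and ap: "associated_pair \<mu> \<gamma> \<tau>"
    and z: "0 < Im z" and st: "0 \<le> s" "s \<le> t"
  shows "Im (recip_H (\<mu> s) z) \<le> Im (recip_H (\<mu> t) z)"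
proof (rule nondecreasing_of_deriv_within[OF st])
  fix r assume "s \<le> r"
  then show "((\<lambda>r. Im (recip_H (\<mu> r) z)) has_real_derivative Im (monotone_field \<gamma> \<tau> (recip_H (\<mu> r) z))) (at r within {0..})"
    using st by (intro has_vector_derivative_Im associated_pairD(4)[OF ap z]) auto
next
  fix r assume "s < r"
  then have "0 \<le> r" using st by simp
  then show "0 \<le> Im (monotone_field \<gamma> \<tau> (recip_H (\<mu> r) z))"
    by (intro Im_monotone_field_nonneg associated_pairD(1,2)[OF ap] Im_recip_H_pos z monotone_semigroupD[OF ms])
qed

text \<open>The barrier lemma keeps the real part at most \<open>Re z\<close> for all time. Along
  the whole trajectory \<open>Im_monotone_field_le\<close> then applies with the same
  \<open>a = - Re z\<close>, and Gronwall's inequality bounds the imaginary part.\<close>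

lemma flow_left_quadrant:
  assumes ms: "monotone_semigroup \<mu>" and ap: "associated_pair \<mu> \<gamma> \<tau>"
    and AE: "AE x in \<tau>. 0 < x"
    and int: "set_integrable \<tau> {0<..} (\<lambda>x. 1 / x)" and \<gamma>: "(\<integral>x\<in>{0<..}. 1 / x \<partial>\<tau>) \<le> \<gamma>"
    and z: "0 < Im z" "Re z < 0" and "0 \<le> t"
  shows "Re (recip_H (\<mu> t) z) \<le> Re z"
    and "Im (recip_H (\<mu> t) z) \<le> Im z * exp ((1 + 1 / (Re z)^2) * measure \<tau> UNIV * t)"
proof -
  note tau = associated_pairD(1,2)[OF ap]
  define h where "h = (\<lambda>t. recip_H (\<mu> t) z)"
  have h0: "h 0 = z" using associated_pairD(3)[OF ap z(1)] by (simp add: h_def)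
  have dh: "(h has_vector_derivative monotone_field \<gamma> \<tau> (h t)) (at t within {0..})" if "0 \<le> t" for t
    unfolding h_def by (rule associated_pairD(4)[OF ap z(1) that])
  have hpos: "0 < Im (h t)" if "0 \<le> t" for t
    unfolding h_def by (intro Im_recip_H_pos monotone_semigroupD[OF ms] that z)
  have Re: "Re (h t) \<le> Re z" if "0 \<le> t" for t
  proof -
    have "Re (h t) \<le> Re (h 0)"
    proof (rule negative_barrier[OF that, where f' = "\<lambda>t. Re (monotone_field \<gamma> \<tau> (h t))"])
      show "Re (h 0) < 0" using z by (simp add: h0)
      show "((\<lambda>t. Re (h t)) has_real_derivative Re (monotone_field \<gamma> \<tau> (h t))) (at t within {0..})" if "0 \<le> t" for t
        by (intro has_vector_derivative_Re dh that)
      show "Re (monotone_field \<gamma> \<tau> (h t)) \<le> 0" if "0 \<le> t" "Re (h t) \<le> 0" for t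
        by (intro Re_monotone_field_nonpos[OF tau AE int \<gamma>] hpos that)
    qed
    then show ?thesis by (simp add: h0)
  qed
  then show "Re (recip_H (\<mu> t) z) \<le> Re z" using \<open>0 \<le> t\<close> by (simp add: h_def)
  define K where "K = (1 + 1 / (Re z)^2) * measure \<tau> UNIV"
  have AE0: "AE x in \<tau>. 0 \<le> x" using AE by eventually_elim simp
  \<comment> \<open>Gronwall with integrating factor \<open>exp (- K * t)\<close>; the sign is
    flipped to fit the monotonicity lemma.\<close>
  have "- (Im (h 0) * exp (- K * 0)) \<le> - (Im (h t) * exp (- K * t))"
  proof (rule nondecreasing_of_deriv_within[OF order_refl \<open>0 \<le> t\<close>,
      where f' = "\<lambda>t. (K * Im (h t) - Im (monotone_field \<gamma> \<tau> (h t))) * exp (- K * t)"])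
    fix s :: real assume "0 \<le> s"
    then show "((\<lambda>t. - (Im (h t) * exp (- K * t))) has_real_derivative
        (K * Im (h s) - Im (monotone_field \<gamma> \<tau> (h s))) * exp (- K * s)) (at s within {0..})"
      by (auto intro!: derivative_eq_intros has_vector_derivative_Im dh simp: algebra_simps)
  next
    fix s :: real assume "0 < s"
    then have "Im (monotone_field \<gamma> \<tau> (h s)) \<le> K * Im (h s)"
      unfolding K_def using Im_monotone_field_le[OF tau AE0 hpos, of s "- Re z"] Re[of s] z by simp
    then show "0 \<le> (K * Im (h s) - Im (monotone_field \<gamma> \<tau> (h s))) * exp (- K * s)" by simp
  qed
  then have "Im (h t) * exp (- K * t) \<le> Im z" by (simp add: h0)
  then have "Im (h t) * exp (- K * t) * exp (K * t) \<le> Im z * exp (K * t)" by (intro mult_right_mono) auto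
  then have "Im (h t) \<le> Im z * exp (K * t)" by (simp add: exp_minus field_simps)
  then show "Im (recip_H (\<mu> t) z) \<le> Im z * exp ((1 + 1 / (Re z)^2) * measure \<tau> UNIV * t)"
    by (simp add: h_def K_def)
qed

text \<open>With \<open>w = recip_H (\<mu> t) z\<close> the Poisson integral is
  \<open>Im w / norm w ^ 2\<close>. The flow bounds make the numerator \<open>O(Im z)\<close> and
  keep \<open>norm w\<close> at least \<open>- Re z\<close>, so Stieltjes inversion applies.\<close>

lemma AE_nonneg_semigroup:
  assumes ms: "monotone_semigroup \<mu>" and ap: "associated_pair \<mu> \<gamma> \<tau>"
    and AE: "AE x in \<tau>. 0 < x"
    and int: "set_integrable \<tau> {0<..} (\<lambda>x. 1 / x)" and \<gamma>: "(\<integral>x\<in>{0<..}. 1 / x \<partial>\<tau>) \<le> \<gamma>"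
    and "0 \<le> t"
  shows "AE x in \<mu> t. 0 \<le> x"
proof (rule AE_nonneg_of_boundary_limit)
  note \<mu> = monotone_semigroupD[OF ms \<open>0 \<le> t\<close>]
  show "finite_measure (\<mu> t)" "sets (\<mu> t) = sets borel" by fact+
  fix u :: real assume "u < 0"
  \<comment> \<open>An explicit majorant of the Poisson integral, continuous at \<open>u\<close> and
    zero there.\<close>
  define b where "b = (\<lambda>z. Im z * exp ((1 + 1 / (Re z)^2) * measure \<tau> UNIV * t) / (Re z)^2)"
  let ?F = "at (complex_of_real u) within {z. 0 < Im z}"
  show "((\<lambda>z. \<integral>x. Im z / norm (z - complex_of_real x)^2 \<partial>\<mu> t) \<longlongrightarrow> 0) ?F"
  proof (rule tendsto_sandwich[where f = "\<lambda>_. 0" and h = b])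
    have evpos: "\<forall>\<^sub>F z in ?F. 0 < Im z" by (simp add: eventually_at_filter)
    show "\<forall>\<^sub>F z in ?F. 0 \<le> (\<integral>x. Im z / norm (z - complex_of_real x)^2 \<partial>\<mu> t)"
      using evpos by eventually_elim (auto intro!: integral_nonneg_AE)
    have "(Re \<longlongrightarrow> Re (of_real u)) ?F" by (intro tendsto_intros)
    then have "\<forall>\<^sub>F z in ?F. Re z < 0" by (rule order_tendstoD) (simp add: \<open>u < 0\<close>)
    then show "\<forall>\<^sub>F z in ?F. (\<integral>x. Im z / norm (z - complex_of_real x)^2 \<partial>\<mu> t) \<le> b z"
      using evpos
    proof eventually_elim
      case (elim z)
      define w where "w = recip_H (\<mu> t) z"
      note flow = flow_left_quadrant[OF ms ap AE int \<gamma> elim(2,1) \<open>0 \<le> t\<close>, folded w_def]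
      have "0 < Im w" unfolding w_def by (rule Im_recip_H_pos[OF \<mu>(1,2) elim(2)])
      have G: "cauchy_G (\<mu> t) z = 1 / w" by (simp add: w_def recip_H_def)
      have "(- Re z)^2 \<le> (- Re w)^2" using flow(1) elim by (intro power_mono) auto
      then have "(Re z)^2 \<le> (Re w)^2" by simp
      also have "\<dots> \<le> norm w ^ 2" unfolding cmod_power2 by simp
      finally have "Im w / norm w ^ 2 \<le> (Im z * exp ((1 + 1 / (Re z)^2) * measure \<tau> UNIV * t)) / (Re z)^2"
        using elim flow(2) \<open>0 < Im w\<close> by (intro frac_le) auto
      then show ?case
        using Im_cauchy_G(1)[OF \<mu>(3,2) elim(2)] by (simp add: G Im_inverse_neg b_def)
    qed
    have "isCont b (of_real u)" unfolding b_def using \<open>u < 0\<close> by (intro continuous_intros) auto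
    moreover have "b (of_real u) = 0" by (simp add: b_def)
    ultimately have "(b \<longlongrightarrow> 0) (at (of_real u))" by (simp add: isCont_def)
    then show "(b \<longlongrightarrow> 0) ?F" by (rule tendsto_within_subset) simp
  qed auto
qed

section \<open>The time average of the flow\<close>

text \<open>The function \<open>e \<mapsto> recip_H (\<mu> (s + e)) z\<close> is differentiated at 0
  in two ways: by the chain rule through \<open>recip_H (\<mu> s)\<close>, with the small time step
  taken first, and as a time shift of the flow. One-sided derivatives at 0 within
  \<open>{0..}\<close> are unique.\<close>

lemma deriv_recip_H_times_field:
  assumes ms: "monotone_semigroup \<mu>" and ap: "associated_pair \<mu> \<gamma> \<tau>"
    and z: "0 < Im z" and "0 \<le> s"
  shows "deriv (recip_H (\<mu> s)) z * monotone_field \<gamma> \<tau> z = monotone_field \<gamma> \<tau> (recip_H (\<mu> s) z)"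
proof -
  note \<mu> = monotone_semigroupD[OF ms]
  note h0 = associated_pairD(3)[OF ap z]
  have "(recip_H (\<mu> s) has_field_derivative deriv (recip_H (\<mu> s)) z) (at z)"
    using recip_H_holomorphic[OF \<mu>(1,2)] z \<open>0 \<le> s\<close> open_upper_half_plane holomorphic_derivI by blast
  then have "(recip_H (\<mu> s) has_field_derivative deriv (recip_H (\<mu> s)) z)
      (at (recip_H (\<mu> 0) z) within (\<lambda>e. recip_H (\<mu> e) z) ` {0..})"
    unfolding h0 by (rule has_field_derivative_at_within)
  with associated_pairD(4)[OF ap z order_refl, unfolded h0]
  have "((recip_H (\<mu> s) \<circ> (\<lambda>e. recip_H (\<mu> e) z)) has_vector_derivative
      monotone_field \<gamma> \<tau> z * deriv (recip_H (\<mu> s)) z) (at 0 within {0..})"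
    by (rule field_vector_diff_chain_within)
  then have 1: "((\<lambda>e. recip_H (\<mu> (s + e)) z) has_vector_derivative
      monotone_field \<gamma> \<tau> z * deriv (recip_H (\<mu> s)) z) (at 0 within {0..})"
  proof (rule has_vector_derivative_transform_within[of _ _ _ _ 1])
    fix e :: real assume "e \<in> {0..}"
    then show "(recip_H (\<mu> s) \<circ> (\<lambda>e. recip_H (\<mu> e) z)) e = recip_H (\<mu> (s + e)) z"
      using ms \<open>0 \<le> s\<close> z by (simp add: monotone_semigroup_def)
  qed auto
  have "((\<lambda>r. recip_H (\<mu> r) z) has_vector_derivative monotone_field \<gamma> \<tau> (recip_H (\<mu> s) z))
      (at (s + 0) within (+) s ` {0..})"
    using associated_pairD(4)[OF ap z \<open>0 \<le> s\<close>] \<open>0 \<le> s\<close>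
    by (auto intro: has_vector_derivative_within_subset)
  moreover have "((+) s has_vector_derivative 1) (at 0 within {0..})"
    by (auto intro!: derivative_eq_intros)
  ultimately have "(((\<lambda>r. recip_H (\<mu> r) z) \<circ> (+) s) has_vector_derivative
      1 *\<^sub>R monotone_field \<gamma> \<tau> (recip_H (\<mu> s) z)) (at 0 within {0..})"
    by (rule vector_diff_chain_within[rotated])
  then have 2: "((\<lambda>e. recip_H (\<mu> (s + e)) z) has_vector_derivative
      monotone_field \<gamma> \<tau> (recip_H (\<mu> s) z)) (at 0 within {0..})"
    by (simp add: o_def)
  have "monotone_field \<gamma> \<tau> z * deriv (recip_H (\<mu> s)) z = monotone_field \<gamma> \<tau> (recip_H (\<mu> s) z)"
    by (rule vector_derivative_unique_within[OF _ 1 2]) (simp add: at_within_Ici_at_right)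
  then show ?thesis by (simp add: mult.commute)
qed

lemma recip_H_continuous_on:
  assumes ap: "associated_pair \<mu> \<gamma> \<tau>" and z: "0 < Im z"
  shows "continuous_on {0..T} (\<lambda>s. recip_H (\<mu> s) z)"
proof (rule continuous_on_subset)
  show "continuous_on {0..} (\<lambda>s. recip_H (\<mu> s) z)"
    unfolding continuous_on_eq_continuous_within
    using has_vector_derivative_continuous[OF associated_pairD(4)[OF ap z]] by auto
qed auto

text \<open>Schwarz-Pick bounds the space derivatives uniformly in \<open>s\<close>, since
  \<open>Im (recip_H (\<mu> s) w)\<close> is largest at \<open>s = T\<close>; this permits
  differentiation under the time integral. Multiplied by the field, the space derivative becomes the
  time derivative, whose integral telescopes.\<close>

lemma time_average_deriv:
  fixes T :: real
  assumes ms: "monotone_semigroup \<mu>" and ap: "associated_pair \<mu> \<gamma> \<tau>"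
    and z: "0 < Im z" and "0 \<le> T"
  defines "F \<equiv> \<lambda>w. integral {0..T} (\<lambda>s. recip_H (\<mu> s) w)"
  shows "F field_differentiable (at z)"
    and "deriv F z * monotone_field \<gamma> \<tau> z = recip_H (\<mu> T) z - z"
proof -
  note \<mu> = monotone_semigroupD[OF ms]
  define H' where "H' = (\<lambda>s. deriv (recip_H (\<mu> s)))"
  have dH: "(recip_H (\<mu> s) has_field_derivative H' s w) (at w)" if "0 \<le> s" "0 < Im w" for s w
    unfolding H'_def using recip_H_holomorphic[OF \<mu>(1,2)[OF that(1)]] that open_upper_half_plane holomorphic_derivI by blast
  have bound: "norm (H' s w) \<le> 2 * Im (recip_H (\<mu> T) w) / Im w" if "0 \<le> s" "s \<le> T" "0 < Im w" for s w
  proof -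
    have "norm (H' s w) \<le> 2 * Im (recip_H (\<mu> s) w) / Im w"
      unfolding H'_def using recip_H_holomorphic[OF \<mu>(1,2)[OF that(1)]] Im_recip_H_pos[OF \<mu>(1,2)[OF that(1)]] that
      by (intro half_plane_deriv_bound) auto
    also have "\<dots> \<le> 2 * Im (recip_H (\<mu> T) w) / Im w"
      using Im_recip_H_mono[OF ms ap that(3,1,2)] that by (intro divide_right_mono) auto
    finally show ?thesis .
  qed
  \<comment> \<open>A derivative bound valid for all \<open>s\<close> in \<open>{0..T}\<close>; by
    continuity of \<open>q\<close> it stays below \<open>B\<close> on a small ball.\<close>
  define q where "q = (\<lambda>w. 2 * Im (recip_H (\<mu> T) w) / Im w)"
  define B where "B = q z + 1"
  have "isCont q z"
    unfolding q_def using DERIV_isCont[OF dH[OF \<open>0 \<le> T\<close> z]] z by (intro continuous_intros) auto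
  then have "\<forall>\<^sub>F w in at z. q w < B"
    unfolding isCont_def by (rule order_tendstoD) (simp add: B_def)
  then obtain d0 where d0: "0 < d0" "\<And>w. \<lbrakk>w \<noteq> z; dist w z < d0\<rbrakk> \<Longrightarrow> q w < B"
    unfolding eventually_at by auto
  define d where "d = min d0 (Im z)"
  have d: "0 < d" using d0 z by (simp add: d_def)
  have ball: "0 < Im w" "q w \<le> B" if "w \<in> ball z d" for w
  proof -
    have "\<bar>Im z - Im w\<bar> < Im z"
      using that abs_Im_le_cmod[of "z - w"] by (simp add: d_def dist_norm)
    then show "0 < Im w" by (simp add: abs_if split: if_splits)
    show "q w \<le> B"
      using d0(2)[of w] that by (cases "w = z") (auto simp: B_def d_def dist_commute less_imp_le)
  qed
  have Lip: "norm (recip_H (\<mu> s) w - recip_H (\<mu> s) z) \<le> B * norm (w - z)"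
    if "0 \<le> s" "s \<le> T" "w \<in> ball z d" for s w
  proof (rule field_differentiable_bound[of "ball z d"])
    fix x assume x: "x \<in> ball z d"
    show "(recip_H (\<mu> s) has_field_derivative H' s x) (at x within ball z d)"
      using dH[OF that(1) ball(1)[OF x]] by (rule has_field_derivative_at_within)
    show "norm (H' s x) \<le> B"
      using bound[OF that(1,2) ball(1)[OF x]] ball(2)[OF x] by (simp add: q_def)
  qed (use that d in auto)
  have intH: "(\<lambda>s. recip_H (\<mu> s) w) integrable_on {0..T}" if "0 < Im w" for w
    by (intro integrable_continuous_real recip_H_continuous_on[OF ap that])
  \<comment> \<open>Dominated convergence yields integrability of the limit as well, so both facts
    are recorded together.\<close>
  have lim: "(\<lambda>s. H' s z) integrable_on {0..T} \<and>
      (\<lambda>i. (F (X i) - F z) / (X i - z)) \<longlonglongrightarrow> integral {0..T} (\<lambda>s. H' s z)"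
    if X: "\<And>i. X i \<in> ball z d - {z}" "X \<longlonglongrightarrow> z" for X
  proof -
    define Q where "Q = (\<lambda>i s. (recip_H (\<mu> s) (X i) - recip_H (\<mu> s) z) / (X i - z))"
    have Imp: "0 < Im (X i)" for i using ball(1) X(1) by blast
    have intQ: "Q i integrable_on {0..T}" for i
      unfolding Q_def by (intro integrable_on_divide integrable_diff intH Imp z)
    have leQ: "norm (Q i s) \<le> B" if "s \<in> {0..T}" for i s
    proof -
      have "norm (X i - z) > 0" using X(1)[of i] by auto
      then show ?thesis
        using Lip[of s "X i"] X(1)[of i] that by (simp add: Q_def norm_divide pos_divide_le_eq)
    qed
    have limQ: "(\<lambda>i. Q i s) \<longlonglongrightarrow> H' s z" if "s \<in> {0..T}" for s
    proof -
      have "filterlim X (at z) sequentially"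
        using X by (intro filterlim_atI) auto
      moreover have "((\<lambda>w. (recip_H (\<mu> s) w - recip_H (\<mu> s) z) / (w - z)) \<longlongrightarrow> H' s z) (at z)"
        using dH[OF _ z, of s] that by (simp add: has_field_derivative_iff)
      ultimately show ?thesis unfolding Q_def by (rule filterlim_compose[rotated])
    qed
    have "(F (X i) - F z) / (X i - z) = integral {0..T} (Q i)" for i
      unfolding F_def Q_def by (simp add: integral_diff[OF intH[OF Imp] intH[OF z]])
    then show ?thesis
      using dominated_convergence[of Q "{0..T}" "\<lambda>_. B" "\<lambda>s. H' s z", OF intQ _ leQ limQ] by auto
  qed
  define F' where "F' = integral {0..T} (\<lambda>s. H' s z)"
  have "((\<lambda>w. (F w - F z) / (w - z)) \<longlongrightarrow> F') (at z within ball z d)"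
    unfolding tendsto_at_iff_sequentially o_def F'_def using lim by blast
  moreover have "at z within ball z d = at z"
    using d by (intro at_within_open) auto
  ultimately have dF: "(F has_field_derivative F') (at z)" by (simp add: has_field_derivative_iff)
  then show "F field_differentiable (at z)" by (auto simp: field_differentiable_def)
  have "(\<lambda>s. H' s z) integrable_on {0..T}"
  proof -
    \<comment> \<open>Any admissible sequence extracts the integrability from \<open>lim\<close>.
      The denominators start at 2 so that all points lie in the open ball and differ from
      \<open>z\<close>.\<close>
    have "(\<lambda>i. z + of_real (d / real (Suc (Suc i)))) \<longlonglongrightarrow> z + of_real 0"
      by (intro tendsto_intros real_tendsto_divide_at_top[OF tendsto_const] filterlim_compose[OF filterlim_real_sequentially] filterlim_compose[OF filterlim_Suc filterlim_Suc])
    moreover have "z + of_real (d / real (Suc (Suc i))) \<in> ball z d - {z}" for i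
    proof -
      have "d / real (Suc (Suc i)) < d" using d by (simp add: field_simps add_pos_nonneg)
      then show ?thesis using d by (simp add: dist_norm norm_divide del: of_nat_Suc)
    qed
    ultimately show ?thesis using lim[of "\<lambda>i. z + of_real (d / real (Suc (Suc i)))"] by simp
  qed
  then have "((\<lambda>s. H' s z * monotone_field \<gamma> \<tau> z) has_integral F' * monotone_field \<gamma> \<tau> z) {0..T}"
    unfolding F'_def by (intro has_integral_mult_left integrable_integral)
  moreover have "((\<lambda>s. H' s z * monotone_field \<gamma> \<tau> z) has_integral recip_H (\<mu> T) z - recip_H (\<mu> 0) z) {0..T}"
  proof (rule fundamental_theorem_of_calculus[OF \<open>0 \<le> T\<close>])
    fix s assume s: "s \<in> {0..T}"
    then have "H' s z * monotone_field \<gamma> \<tau> z = monotone_field \<gamma> \<tau> (recip_H (\<mu> s) z)"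
      unfolding H'_def by (intro deriv_recip_H_times_field[OF ms ap z]) auto
    then show "((\<lambda>s. recip_H (\<mu> s) z) has_vector_derivative H' s z * monotone_field \<gamma> \<tau> z) (at s within {0..T})"
      using associated_pairD(4)[OF ap z, of s] s by (auto intro: has_vector_derivative_within_subset)
  qed
  ultimately show "deriv F z * monotone_field \<gamma> \<tau> z = recip_H (\<mu> T) z - z"
    using has_integral_unique DERIV_imp_deriv[OF dF] associated_pairD(3)[OF ap z] by metis
qed

text \<open>The field is the quotient of \<open>recip_H (\<mu> T) z - z\<close> by the derivative of
  the time average. At \<open>u\<close> the numerator tends to \<open>h - u \<le> 0\<close> and the
  denominator to a real \<open>L \<ge> T > 0\<close>.\<close>

lemma monotone_field_nonpos_limit:
  assumes ms: "monotone_semigroup \<mu>" and ap: "associated_pair \<mu> \<gamma> \<tau>"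
    and "0 < T" and AE: "AE x in \<mu> T. 0 \<le> x" and "u < 0"
  obtains l where "l \<le> 0" "(monotone_field \<gamma> \<tau> \<longlongrightarrow> complex_of_real l) (at (of_real u) within {z. 0 < Im z})"
proof -
  let ?F = "at (complex_of_real u) within {z. 0 < Im z}"
  have T: "0 \<le> T" using \<open>0 < T\<close> by simp
  note \<mu> = monotone_semigroupD[OF ms T]
  define F where "F = (\<lambda>w. integral {0..T} (\<lambda>s. recip_H (\<mu> s) w))"
  have intH: "(\<lambda>s. recip_H (\<mu> s) w) integrable_on {0..T}" if "0 < Im w" for w
    by (intro integrable_continuous_real recip_H_continuous_on[OF ap that])
  have F: "F field_differentiable (at z)" "deriv F z * monotone_field \<gamma> \<tau> z = recip_H (\<mu> T) z - z" if "0 < Im z" for z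
    using time_average_deriv[OF ms ap that T] by (simp_all add: F_def)
  have ImF: "Im (F z) = integral {0..T} (\<lambda>s. Im (recip_H (\<mu> s) z))" "(\<lambda>s. Im (recip_H (\<mu> s) z)) integrable_on {0..T}"
    if "0 < Im z" for z
    using integral_linear[OF intH[OF that] bounded_linear_Im] integrable_linear[OF intH[OF that] bounded_linear_Im]
    by (simp_all add: F_def o_def)
  have lower: "T * Im z \<le> Im (F z)" if "0 < Im z" for z
  proof -
    have "integral {0..T} (\<lambda>s. Im z) \<le> integral {0..T} (\<lambda>s. Im (recip_H (\<mu> s) z))"
    proof (rule integral_le)
      fix s assume "s \<in> {0..T}"
      then show "Im z \<le> Im (recip_H (\<mu> s) z)"
        using Im_recip_H_mono[OF ms ap that, of 0 s] associated_pairD(3)[OF ap that] by simp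
    qed (auto intro: ImF that)
    then show ?thesis using T by (simp add: ImF that)
  qed
  obtain r C where Cr: "0 < r" "\<And>z. \<lbrakk>0 < Im z; norm (z - of_real u) < r\<rbrakk> \<Longrightarrow> Im (recip_H (\<mu> T) z) \<le> C * Im z"
    by (rule Im_recip_H_le_near_negative_axis[OF \<mu>(1,2) AE \<open>u < 0\<close>]) (rule that)
  \<comment> \<open>The support hypothesis gives a bound at time \<open>T\<close> only; monotonicity
    in time carries it to all earlier \<open>s\<close>.\<close>
  have upper: "Im (F z) \<le> T * C * Im z" if "0 < Im z" "norm (z - of_real u) < r" for z
  proof -
    have "integral {0..T} (\<lambda>s. Im (recip_H (\<mu> s) z)) \<le> integral {0..T} (\<lambda>s. C * Im z)"
    proof (rule integral_le)
      fix s assume "s \<in> {0..T}"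
      then show "Im (recip_H (\<mu> s) z) \<le> C * Im z"
        using Im_recip_H_mono[OF ms ap that(1), of s T] Cr(2)[OF that] by simp
    qed (auto intro: ImF that)
    then show ?thesis using T by (simp add: ImF that mult_ac)
  qed
  have "F holomorphic_on {z. 0 < Im z}"
    using F(1) field_differentiable_at_within by (auto simp: holomorphic_on_def)
  from half_plane_deriv_boundary_limit[OF this \<open>0 < T\<close> Cr(1) lower upper]
  obtain L where L: "T \<le> L" "(deriv F \<longlongrightarrow> of_real L) ?F" by blast
  obtain h where h: "h \<le> u" "recip_H (\<mu> T) (of_real u) = of_real h" "isCont (recip_H (\<mu> T)) (of_real u)"
    using recip_H_negative_axis[OF \<mu>(1,2) AE \<open>u < 0\<close>] by blast
  have "(recip_H (\<mu> T) \<longlongrightarrow> of_real h) ?F"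
    using tendsto_within_subset[OF h(3)[unfolded isCont_def h(2)] subset_UNIV] .
  then have "((\<lambda>z. (recip_H (\<mu> T) z - z) / deriv F z) \<longlongrightarrow> (of_real h - of_real u) / of_real L) ?F"
    using L \<open>0 < T\<close> by (intro tendsto_intros) auto
  moreover have "\<forall>\<^sub>F z in ?F. (recip_H (\<mu> T) z - z) / deriv F z = monotone_field \<gamma> \<tau> z"
  proof -
    have "\<forall>\<^sub>F z in ?F. deriv F z \<noteq> 0"
      using L \<open>0 < T\<close> by (intro tendsto_imp_eventually_ne[OF L(2)]) auto
    moreover have "\<forall>\<^sub>F z in ?F. 0 < Im z" by (simp add: eventually_at_filter)
    ultimately show ?thesis
    proof eventually_elim
      case (elim z)
      then show ?case using F(2)[of z] by (simp add: divide_simps mult.commute)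
    qed
  qed
  ultimately have "(monotone_field \<gamma> \<tau> \<longlongrightarrow> (of_real h - of_real u) / of_real L) ?F"
    by (rule Lim_transform_eventually)
  then show ?thesis
    using that[of "(h - u) / L"] h(1) L(1) \<open>0 < T\<close> by (simp add: divide_nonpos_pos)
qed

text \<open>Real boundary values make \<open>Im A\<close> tend to 0, and \<open>Im A\<close>
  dominates the Poisson integral of \<tau>.\<close>

lemma AE_nonneg_of_field:
  assumes fin: "finite_measure \<tau>" and sets: "sets \<tau> = sets borel"
    and lim: "\<And>u. u < 0 \<Longrightarrow> \<exists>l. (monotone_field \<gamma> \<tau> \<longlongrightarrow> complex_of_real l) (at (of_real u) within {z. 0 < Im z})"
  shows "AE x in \<tau>. 0 \<le> x"
proof (rule AE_nonneg_of_boundary_limit[OF fin sets])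
  fix u :: real assume "u < 0"
  let ?F = "at (complex_of_real u) within {z. 0 < Im z}"
  obtain l where l: "(monotone_field \<gamma> \<tau> \<longlongrightarrow> complex_of_real l) ?F" using lim[OF \<open>u < 0\<close>] by blast
  have evpos: "\<forall>\<^sub>F z in ?F. 0 < Im z" by (simp add: eventually_at_filter)
  show "((\<lambda>z. \<integral>x. Im z / norm (z - complex_of_real x)^2 \<partial>\<tau>) \<longlongrightarrow> 0) ?F"
  proof (rule tendsto_sandwich[where f = "\<lambda>_. 0"])
    show "\<forall>\<^sub>F z in ?F. 0 \<le> (\<integral>x. Im z / norm (z - complex_of_real x)^2 \<partial>\<tau>)"
      using evpos by eventually_elim (auto intro!: integral_nonneg_AE)
    show "\<forall>\<^sub>F z in ?F. (\<integral>x. Im z / norm (z - complex_of_real x)^2 \<partial>\<tau>) \<le> Im (monotone_field \<gamma> \<tau> z)"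
      using evpos by eventually_elim (rule poisson_le_Im_monotone_field[OF fin sets])
    show "((\<lambda>z. Im (monotone_field \<gamma> \<tau> z)) \<longlongrightarrow> 0) ?F" using tendsto_Im[OF l] by simp
  qed auto
qed

section \<open>The equivalence\<close>

text \<open>As \<open>u\<close> increases to 0 the integrand tends to \<open>1 / x\<close> for
  \<open>x > 0\<close> and to infinity at \<open>x = 0\<close>. A uniform bound on the integrals
  thus excludes an atom at 0, makes \<open>1 / x\<close> integrable and bounds its integral by
  \<gamma>.\<close>

lemma nonpos_field_imp_integral_le:
  assumes fin: "finite_measure \<tau>" and sets: "sets \<tau> = sets borel" and AE: "AE x in \<tau>. 0 \<le> x"
    and field: "\<And>u. u < 0 \<Longrightarrow> - \<gamma> + (\<integral>x. (1 + x * u) / (x - u) \<partial>\<tau>) \<le> 0"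
  shows "emeasure \<tau> {0} = 0" "(\<integral>\<^sup>+x\<in>{0<..}. ennreal (1 / x) \<partial>\<tau>) < \<infinity>"
    "(\<integral>x\<in>{0<..}. 1 / x \<partial>\<tau>) \<le> \<gamma>"
proof -
  interpret finite_measure \<tau> by fact
  note [measurable_cong] = sets
  note space = sets_eq_imp_space_eq[OF sets, simplified]
  define m where "m = measure \<tau> UNIV"
  \<comment> \<open>Starting at \<open>-1\<close> gives \<open>1 + u n \<ge> 0\<close>, which makes
    the shifted integrand \<open>f n x + 1\<close> nonnegative for all
    \<open>x \<ge> 0\<close>.\<close>
  define u where "u = (\<lambda>n. - 1 / real (Suc n))"
  have u: "u n < 0" "- 1 \<le> u n" for n by (simp_all add: u_def)
  have u0: "u \<longlonglongrightarrow> 0"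
    unfolding u_def using tendsto_minus[OF LIMSEQ_inverse_real_of_nat] by (simp add: inverse_eq_divide)
  define f where "f = (\<lambda>n x. (1 + x * u n) / (x - u n))"
  have nonneg: "0 \<le> f n x + 1" if "0 \<le> x" for n x
  proof -
    have "f n x + 1 = (1 + x * (1 + u n) - u n) / (x - u n)"
      using u(1)[of n] that by (simp add: f_def field_simps)
    moreover have "0 \<le> x * (1 + u n)" using u(2)[of n] that by (intro mult_nonneg_nonneg) auto
    ultimately show ?thesis using u(1)[of n] that by simp
  qed
  have intf: "integrable \<tau> (f n)" for n
  proof -
    have "AE x in \<tau>. - u n \<le> norm (complex_of_real (u n) - of_real x)"
      using AE_neg_le_norm[OF AE, of "of_real (u n)"] u(1) by simp
    then have "integrable \<tau> (\<lambda>x. (1 + complex_of_real x * of_real (u n)) / (complex_of_real x - of_real (u n)))"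
      using u(1)[of n] by (intro monotone_field_eq(2)[OF fin sets, of "- u n"]) auto
    then have "integrable \<tau> (\<lambda>x. Re ((1 + complex_of_real x * of_real (u n)) / (complex_of_real x - of_real (u n))))"
      by (rule integrable_Re)
    moreover have "Re ((1 + complex_of_real x * of_real (u n)) / (complex_of_real x - of_real (u n))) = f n x" for x
    proof -
      have "(1 + complex_of_real x * of_real (u n)) / (complex_of_real x - of_real (u n)) = of_real (f n x)"
        by (simp add: f_def)
      then show ?thesis by simp
    qed
    ultimately show ?thesis by (simp only:)
  qed
  have int1: "integrable \<tau> (\<lambda>x. f n x + 1)" for n using intf by simp
  have le: "(\<integral>x. f n x + 1 \<partial>\<tau>) \<le> \<gamma> + m" for n
    using field[OF u(1), of n] intf[of n] by (simp add: f_def m_def space)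
  have nn: "0 \<le> (\<integral>x. f n x + 1 \<partial>\<tau>)" for n
    using AE by (intro integral_nonneg_AE) (auto intro: nonneg elim!: eventually_mono)
  \<comment> \<open>This lets the final inequality be read back from \<open>ennreal\<close>, which
    truncates negative numbers to 0.\<close>
  have \<gamma>m: "0 \<le> \<gamma> + m" using le[of 0] nn[of 0] by linarith
  \<comment> \<open>limit of \<open>f n + 1\<close>; the shift by 1 makes the integrands nonnegative, so Fatou's lemma applies\<close>
  define G where "G = (\<lambda>x::real. if x = 0 then \<infinity> else ennreal (1 / x + 1))"
  have lim: "(\<lambda>n. ennreal (f n x + 1)) \<longlonglongrightarrow> G x" if "0 \<le> x" for x
  proof (cases "x = 0")
    case True
    have "filterlim (\<lambda>n. real (Suc n) + 1) at_top sequentially"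
      by real_asymp
    then have "(\<lambda>n. ennreal (real (Suc n) + 1)) \<longlonglongrightarrow> \<infinity>"
      by (simp only: ennreal_tendsto_top_eq_at_top infinity_ennreal_def)
    moreover have "f n 0 = real (Suc n)" for n by (simp add: f_def u_def)
    ultimately show ?thesis unfolding True by (simp add: G_def)
  next
    case False
    have "(\<lambda>n. f n x + 1) \<longlonglongrightarrow> (1 + x * 0) / (x - 0) + 1"
      unfolding f_def using False by (intro tendsto_intros u0) auto
    then show ?thesis using False by (simp add: G_def tendsto_ennrealI)
  qed
  have Gle: "(\<integral>\<^sup>+x. G x \<partial>\<tau>) \<le> ennreal (\<gamma> + m)"
  proof -
    have "(\<integral>\<^sup>+x. G x \<partial>\<tau>) = (\<integral>\<^sup>+x. liminf (\<lambda>n. ennreal (f n x + 1)) \<partial>\<tau>)"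
    proof (rule nn_integral_cong_AE)
      show "AE x in \<tau>. G x = liminf (\<lambda>n. ennreal (f n x + 1))"
        using AE by eventually_elim (use lim lim_imp_Liminf[OF sequentially_bot] in force)
    qed
    also have "\<dots> \<le> liminf (\<lambda>n. \<integral>\<^sup>+x. ennreal (f n x + 1) \<partial>\<tau>)"
      by (rule nn_integral_liminf) (use int1 in auto)
    also have "\<dots> \<le> liminf (\<lambda>n. ennreal (\<gamma> + m))"
    proof (intro Liminf_mono always_eventually allI)
      fix n
      have "(\<integral>\<^sup>+x. ennreal (f n x + 1) \<partial>\<tau>) = ennreal (\<integral>x. f n x + 1 \<partial>\<tau>)"
        by (rule nn_integral_eq_integral[OF int1]) (use AE in eventually_elim, simp add: nonneg)
      then show "(\<integral>\<^sup>+x. ennreal (f n x + 1) \<partial>\<tau>) \<le> ennreal (\<gamma> + m)"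
        using le[of n] by (simp add: ennreal_leI)
    qed
    also have "\<dots> = ennreal (\<gamma> + m)" by (simp add: Liminf_const)
    finally show ?thesis .
  qed
  \<comment> \<open>\<open>G\<close> is infinite at 0, so an atom there would make its integral
    infinite.\<close>
  have "\<infinity> * emeasure \<tau> {0} = (\<integral>\<^sup>+x. \<infinity> * indicator {0} x \<partial>\<tau>)"
    by (subst nn_integral_cmult_indicator) (auto simp: sets)
  also have "\<dots> \<le> (\<integral>\<^sup>+x. G x \<partial>\<tau>)" by (intro nn_integral_mono) (auto simp: G_def indicator_def)
  also have "\<dots> < \<infinity>" using Gle by (simp add: order_le_less_trans)
  finally show zero: "emeasure \<tau> {0} = 0" by (auto simp: ennreal_top_mult split: if_splits)
  have AE0: "AE x in \<tau>. 0 < x"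
  proof -
    have "AE x in \<tau>. x \<notin> {0}" by (subst AE_iff_null_sets[symmetric]) (auto simp: sets zero null_sets_def)
    with AE show ?thesis by eventually_elim auto
  qed
  have "(\<integral>\<^sup>+x\<in>{0<..}. ennreal (1 / x) \<partial>\<tau>) \<le> (\<integral>\<^sup>+x. G x \<partial>\<tau>)"
    by (intro nn_integral_mono) (auto simp: G_def indicator_def ennreal_leI)
  also have "\<dots> < \<infinity>" using Gle by (simp add: order_le_less_trans)
  finally show fin_int: "(\<integral>\<^sup>+x\<in>{0<..}. ennreal (1 / x) \<partial>\<tau>) < \<infinity>" .
  define k where "k = (\<lambda>x::real. indicator {0<..} x *\<^sub>R (1 / x))"
  have k: "0 \<le> k x" "ennreal (k x) = ennreal (1 / x) * indicator {0<..} x" for x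
    by (auto simp: k_def indicator_def)
  have intk: "integrable \<tau> k"
    by (rule integrableI_nonneg) (use fin_int k in \<open>auto simp: k_def\<close>)
  \<comment> \<open>Almost everywhere \<open>G\<close> equals \<open>k + 1\<close>; the total mass
    \<open>m\<close> then cancels on both sides.\<close>
  have "ennreal (\<integral>x. k x + 1 \<partial>\<tau>) = (\<integral>\<^sup>+x. ennreal (k x + 1) \<partial>\<tau>)"
    by (rule nn_integral_eq_integral[symmetric]) (use intk k(1) in \<open>auto intro: add_nonneg_nonneg\<close>)
  also have "\<dots> \<le> (\<integral>\<^sup>+x. G x \<partial>\<tau>)"
    by (rule nn_integral_mono_AE) (use AE0 in eventually_elim, simp add: G_def k_def)
  also note Gle
  finally have "(\<integral>x. k x + 1 \<partial>\<tau>) \<le> \<gamma> + m" using \<gamma>m by simp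
  then show "(\<integral>x\<in>{0<..}. 1 / x \<partial>\<tau>) \<le> \<gamma>"
    using intk by (simp add: set_lebesgue_integral_def k_def m_def space)
qed

theorem theorem6p2:
  fixes \<mu> :: "real \<Rightarrow> real measure" and \<gamma> :: real and \<tau> :: "real measure"
  assumes "monotone_semigroup \<mu>"
    and "associated_pair \<mu> \<gamma> \<tau>"
  shows "((\<exists>t0>0. measure_support (\<mu> t0) \<subseteq> {0..})
            \<longleftrightarrow> (\<forall>t\<ge>0. measure_support (\<mu> t) \<subseteq> {0..}))
       \<and> ((\<forall>t\<ge>0. measure_support (\<mu> t) \<subseteq> {0..})
            \<longleftrightarrow> (measure_support \<tau> \<subseteq> {0..} \<and> emeasure \<tau> {0} = 0 \<and>
                 (\<integral>\<^sup>+x\<in>{0<..}. ennreal (1 / x) \<partial>\<tau>) < \<infinity> \<and>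
                 \<gamma> \<ge> (\<integral>x\<in>{0<..}. 1 / x \<partial>\<tau>)))"
proof -
  note \<mu> = monotone_semigroupD[OF assms(1)] and \<tau> = associated_pairD(1,2)[OF assms(2)]
  let ?one = "\<exists>t0>0. measure_support (\<mu> t0) \<subseteq> {0..}"
  let ?two = "\<forall>t\<ge>0. measure_support (\<mu> t) \<subseteq> {0..}"
  let ?three = "measure_support \<tau> \<subseteq> {0..} \<and> emeasure \<tau> {0} = 0 \<and>
    (\<integral>\<^sup>+x\<in>{0<..}. ennreal (1 / x) \<partial>\<tau>) < \<infinity> \<and> \<gamma> \<ge> (\<integral>x\<in>{0<..}. 1 / x \<partial>\<tau>)"
  \<comment> \<open>The equivalences are closed by the cycle (2) to (1) to (3) to (2).\<close>
  have "?two \<Longrightarrow> ?one" by (meson less_imp_le zero_less_one)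
  moreover have "?three" if one: ?one
  proof -
    from one obtain T where T: "0 < T" "AE x in \<mu> T. 0 \<le> x"
      using measure_support_nonneg_iff \<mu>(2) by (metis less_imp_le)
    have lim: "\<exists>l\<le>0. (monotone_field \<gamma> \<tau> \<longlongrightarrow> complex_of_real l) (at (of_real u) within {z. 0 < Im z})"
      if "u < 0" for u
      using monotone_field_nonpos_limit[OF assms T that] by blast
    have AE: "AE x in \<tau>. 0 \<le> x" using lim by (intro AE_nonneg_of_field[OF \<tau>]) blast
    have "- \<gamma> + (\<integral>x. (1 + x * u) / (x - u) \<partial>\<tau>) \<le> 0" if "u < 0" for u
    proof -
      obtain l where l: "l \<le> 0" "(monotone_field \<gamma> \<tau> \<longlongrightarrow> complex_of_real l) (at (of_real u) within {z. 0 < Im z})"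
        using lim[OF \<open>u < 0\<close>] by blast
      \<comment> \<open>Limits at \<open>u\<close> from the half-plane are unique, so the
        nonpositive limit \<open>l\<close> is the explicit real integral.\<close>
      have "complex_of_real u islimpt {z. 0 < Im z}"
        unfolding islimpt_approachable
      proof (intro allI impI)
        fix e :: real assume "0 < e"
        then show "\<exists>z\<in>{z. 0 < Im z}. z \<noteq> of_real u \<and> dist z (of_real u) < e"
          by (intro bexI[of _ "of_real u + \<i> * of_real (e/2)"]) (auto simp: dist_norm norm_mult)
      qed
      then have "at (complex_of_real u) within {z. 0 < Im z} \<noteq> bot" by (simp add: trivial_limit_within)
      from tendsto_unique[OF this l(2) monotone_field_boundary_limit[OF \<tau> AE that]] l(1)
      show ?thesis by (simp only: of_real_eq_iff)
    qed
    from nonpos_field_imp_integral_le[OF \<tau> AE this] show ?three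
      using AE measure_support_nonneg_iff[OF \<tau>(2)] by simp
  qed
  moreover have ?two if three: ?three
  proof -
    note [measurable_cong] = \<tau>(2)
    have "AE x in \<tau>. 0 \<le> x" using three measure_support_nonneg_iff[OF \<tau>(2)] by simp
    moreover have "AE x in \<tau>. x \<notin> {0}"
      using three by (subst AE_iff_null_sets[symmetric]) (auto simp: \<tau>(2) null_sets_def)
    ultimately have AE: "AE x in \<tau>. 0 < x" by eventually_elim auto
    have "(\<integral>\<^sup>+x. ennreal (indicator {0<..} x *\<^sub>R (1 / x)) \<partial>\<tau>) = (\<integral>\<^sup>+x\<in>{0<..}. ennreal (1 / x) \<partial>\<tau>)"
      by (intro nn_integral_cong) (auto simp: indicator_def)
    \<comment> \<open>Finiteness of the nonnegative integral gives integrability, so the Bochner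
      integral compared with \<gamma> is the true value and not the default 0.\<close>
    then have "set_integrable \<tau> {0<..} (\<lambda>x. 1 / x)"
      unfolding set_integrable_def using three
      by (intro integrableI_nonneg) (auto simp: indicator_def)
    with three AE have "AE x in \<mu> t. 0 \<le> x" if "0 \<le> t" for t
      by (intro AE_nonneg_semigroup[OF assms _ _ _ that]) auto
    then show ?two using measure_support_nonneg_iff[OF \<mu>(2)] by simp
  qed
  ultimately show ?thesis by blast
qed

end
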